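(* Let $c>0$. For any $\delta,T>0$ such that $T/\delta$ is an integer, $$\mathcal{P}_\delta(u,T)\sim \mathcal{H}_{2c^2\delta,\,2c^2T}\;\psi_\infty(u),\qquad u\to\infty.$$
   Context: $B$ is a standard Brownian motion, $c>0$ is a fixed constant, and $R_u(t)=u+ct-B(t)$, $t\ge0$, for $u>0$. For $\alpha>0$ write $\alpha\mathbb{Z}=\{\alpha k:k\in\mathbb{Z}\}$. Parisian ruin probability on the grid of step $\delta$: $$\mathcal{P}_\delta(u,T)=\mathbb{P}\left\{\inf_{t\in[0,\infty)\cap\delta\mathbb{Z}}\ \sup_{s\in[t,t+T]\cap\delta\mathbb{Z}}R_u(s)<0\right\}.$$ $\psi_\infty(u)=\mathbb{P}\{\inf_{t\ge0}R_u(t)<0\}=e^{-2cu}$. For $\eta,T>0$, $$\mathcal{H}_{\eta,T}=\mathbb{E}\left\{\frac{\sup_{t\in\eta\mathbb{Z}}\ \inf_{s\in[t,t+T]\cap\eta\mathbb{Z}}e^{\sqrt2 B(s)-|s|}}{\eta\sum_{t\in\eta\mathbb{Z}}e^{\sqrt2B(t)-|t|}}\right\}\in(0,\infty),$$ with $B$ here a two-sided standard Brownian motion. $f(u)\sim g(u)$ as $u\to\infty$ means $f(u)/g(u)\to1$. *)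

theory Defs
  imports "HOL-Probability.Probability"
begin

text \<open>Brownian motion indexed by a set \<open>I\<close> of times with \<open>0 \<in> I\<close>: the one-sided case is
  \<open>I = {0..}\<close>, the two-sided case is \<open>I = UNIV\<close>. Every path (and not merely almost every path) is
  taken to be continuous, so that infima over uncountable sets of times are measurable without
  completing \<open>M\<close>. Note that \<open>normal_density\<close> is parametrised by the standard deviation.\<close>

definition brownian_motion_on :: "real set \<Rightarrow> 'a measure \<Rightarrow> (real \<Rightarrow> 'a \<Rightarrow> real) \<Rightarrow> bool" where
  "brownian_motion_on I M B \<longleftrightarrow>
     prob_space M \<and>
     (\<forall>t\<in>I. B t \<in> borel_measurable M) \<and>
     (AE \<omega> in M. B 0 \<omega> = 0) \<and>
     (\<forall>s\<in>I. \<forall>t\<in>I. s < t \<longrightarrow>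
        distributed M lborel (\<lambda>\<omega>. B t \<omega> - B s \<omega>) (normal_density 0 (sqrt (t - s)))) \<and>
     (\<forall>(n::nat) (t :: nat \<Rightarrow> real). strict_mono_on {..n} t \<and> t ` {..n} \<subseteq> I \<longrightarrow>
        prob_space.indep_vars M (\<lambda>_. borel) (\<lambda>k \<omega>. B (t (Suc k)) \<omega> - B (t k) \<omega>) {..<n}) \<and>
     (\<forall>\<omega>\<in>space M. continuous_on I (\<lambda>t. B t \<omega>))"

abbreviation standard_brownian_motion :: "'a measure \<Rightarrow> (real \<Rightarrow> 'a \<Rightarrow> real) \<Rightarrow> bool" where
  "standard_brownian_motion \<equiv> brownian_motion_on {0..}"

abbreviation two_sided_brownian_motion :: "'a measure \<Rightarrow> (real \<Rightarrow> 'a \<Rightarrow> real) \<Rightarrow> bool" where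
  "two_sided_brownian_motion \<equiv> brownian_motion_on UNIV"

definition grid :: "real \<Rightarrow> real set" where
  "grid \<alpha> = {\<alpha> * of_int k | k :: int. True}"

definition risk_process ::
  "(real \<Rightarrow> 'a \<Rightarrow> real) \<Rightarrow> real \<Rightarrow> real \<Rightarrow> real \<Rightarrow> 'a \<Rightarrow> real" where
  "risk_process B c u t \<omega> = u + c * t - B t \<omega>"

text \<open>Infima and suprema over unbounded sets of times are taken in \<open>ereal\<close> and \<open>ennreal\<close>, because
  on \<open>real\<close> they are unspecified for unbounded families.\<close>

definition parisian_ruin_prob ::
  "'a measure \<Rightarrow> (real \<Rightarrow> 'a \<Rightarrow> real) \<Rightarrow> real \<Rightarrow> real \<Rightarrow> real \<Rightarrow> real \<Rightarrow> real" where
  "parisian_ruin_prob M B c \<delta> u T =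
     measure M {\<omega> \<in> space M.
       (INF t \<in> {0..} \<inter> grid \<delta>. SUP s \<in> {t..t + T} \<inter> grid \<delta>. ereal (risk_process B c u s \<omega>)) < 0}"

definition ruin_prob :: "'a measure \<Rightarrow> (real \<Rightarrow> 'a \<Rightarrow> real) \<Rightarrow> real \<Rightarrow> real \<Rightarrow> real" where
  "ruin_prob M B c u =
     measure M {\<omega> \<in> space M. (INF t \<in> {0..}. ereal (risk_process B c u t \<omega>)) < 0}"

text \<open>The constant \<open>\<H>\<^sub>\<eta>\<^sub>,\<^sub>T\<close>, computed from a two-sided Brownian motion \<open>W\<close> on \<open>N\<close>; it depends
  only on the law of \<open>W\<close>.\<close>

definition parisian_constant ::
  "'b measure \<Rightarrow> (real \<Rightarrow> 'b \<Rightarrow> real) \<Rightarrow> real \<Rightarrow> real \<Rightarrow> real" where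
  "parisian_constant N W \<eta> T =
     enn2real (\<integral>\<^sup>+ \<omega>.
       (SUP t \<in> grid \<eta>. INF s \<in> {t..t + T} \<inter> grid \<eta>. ennreal (exp (sqrt 2 * W s \<omega> - \<bar>s\<bar>)))
       / (ennreal \<eta> * (\<Sum>\<^sub>\<infinity> t \<in> grid \<eta>. ennreal (exp (sqrt 2 * W t \<omega> - \<bar>t\<bar>)))) \<partial>N)"

end

theory Submission
  imports Defs "HOL-Real_Asymp.Real_Asymp"
begin

text \<open>Seen along the grid, \<open>2c(u - R\<^sub>u)\<close> is the walk \<open>Z\<close> with steps of mean \<open>-\<eta>\<close> and variance
  \<open>2\<eta>\<close>, \<open>\<eta> = 2c\<^sup>2\<delta>\<close>, and Parisian ruin means that \<open>Z\<close> stays above \<open>a = 2cu\<close> on some window of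
  \<open>m + 1\<close> points. Decompose by the last such window: its start splits the walk into independent past
  and future, so \<open>e\<^sup>a\<close> times the probability is the integral of \<open>e\<^sup>v P(last window above v starts at 0)\<close>
  against the renewal density, at \<open>a - v\<close>, of the walk with the opposite drift. That density tends to
  \<open>1/\<eta>\<close>. Hence the limit is \<open>1/\<eta>\<close> times the expected \<open>e\<^sup>v dv\<close>-measure of the levels \<open>v\<close> whose last
  window starts at 0. For the two-sided walk the corresponding measures over all starting points add
  up to the supremum in \<open>\<H>\<close>, and shifting the origin from 0 to \<open>i\<close> is an exponential tilt; summing
  the tilts cancels the denominator of \<open>\<H>\<close> and identifies the limit. The identity
  \<open>\<psi>\<^sub>\<infinity>(u) = e\<^sup>-\<^sup>a\<close> comes from the same tilt on dyadic grids, where the overshoot over \<open>a\<close>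
  vanishes as the mesh tends to 0.\<close>

section \<open>Product measures\<close>

text \<open>The last window is used rather than the first because being last constrains only the
  future, so the past enters through its unconditioned Gaussian law. A first window would condition
  the past on containing no earlier window, and windows overlap. The convergence of the renewal
  density is computed and not quoted from renewal theory. At \<open>x\<close> it is the sum over
  grid times s of the density at \<open>x\<close> of the normal law with mean s and variance 2s. As
  a function of s this density is unimodal with integral exactly 1, so \<eta> times the sum is a
  Riemann sum whose error is governed by the peak, of order x^(-1/2). A window starting at 0
  contains the value 0, so only levels v < 0 occur; this makes the error uniform in v. The weight
  e^v dv serves two purposes: the levels below y have mass e^y, and moving the origin of the walk
  rescales this mass by the same factor as the sum in the denominator of the constant.\<close>

lemma (in prob_space) distr_eq_PiM:
  fixes X :: "'i \<Rightarrow> 'a \<Rightarrow> real"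
  assumes X: "\<And>i. distr M borel (X i) = L i" "\<And>i. X i \<in> borel_measurable M"
    and indep: "\<And>J. finite J \<Longrightarrow> \<exists>f n. inj_on f {..<n::nat} \<and> J \<subseteq> f ` {..<n} \<and>
      indep_vars (\<lambda>_. borel) (\<lambda>k. X (f k)) {..<n}"
  shows "distr M (PiM UNIV L) (\<lambda>\<omega> i. X i \<omega>) = PiM UNIV L"
proof -
  have sL: "sets (L i) = sets borel" for i by (simp flip: X(1))
  have pL: "prob_space (L i)" for i
    unfolding X(1)[symmetric] by (rule prob_space_distr) (rule X(2))
  interpret L: product_prob_space L UNIV
    by (intro product_prob_spaceI pL)
  have meas: "(\<lambda>\<omega> i. X i \<omega>) \<in> measurable M (PiM UNIV L)"
    by (rule measurable_PiM_single') (auto simp: X(2) space_PiM cong: measurable_cong_sets[OF refl sL] intro: sets_eq_imp_space_eq[OF sL, THEN equalityD2, THEN subsetD])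
  show ?thesis
  proof (rule L.PiM_eq)
    fix J F assume J: "finite J" "J \<subseteq> UNIV" and F: "\<And>j. j \<in> J \<Longrightarrow> F j \<in> sets (L j)"
    let ?E = "prod_emb UNIV L J (\<Pi>\<^sub>E j\<in>J. F j)"
    have spL: "space (L i) = UNIV" for i using sets_eq_imp_space_eq[OF sL] by simp
    have E: "?E = {x. \<forall>j\<in>J. x j \<in> F j}"
      by (auto simp: prod_emb_def spL PiE_iff restrict_def)
    have "?E \<in> sets (PiM UNIV L)"
      using J F by (intro sets_PiM_I) auto
    then have "emeasure (distr M (PiM UNIV L) (\<lambda>\<omega> i. X i \<omega>)) ?E =
        emeasure M ((\<lambda>\<omega> i. X i \<omega>) -` ?E \<inter> space M)"
      by (intro emeasure_distr meas)
    also have "\<dots> = (\<Prod>j\<in>J. emeasure (L j) (F j))"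
    proof (cases "J = {}")
      case True
      then show ?thesis unfolding E by (simp add: emeasure_space_1)
    next
      case False
      \<comment> \<open>Independence is phrased through an enumeration because Brownian increments
        are independent along finite increasing sequences of times; \<open>?K\<close> keeps the
        enumerated coordinates that lie in \<open>J\<close>.\<close>
      obtain f n where f: "inj_on f {..<n::nat}" "J \<subseteq> f ` {..<n}"
          and ind: "indep_vars (\<lambda>_. borel) (\<lambda>k. X (f k)) {..<n}"
        using indep[OF J(1)] by blast
      let ?K = "{k \<in> {..<n}. f k \<in> J}"
      have K: "f ` ?K = J" "inj_on f ?K" using f by (auto intro: inj_on_subset)
      have "(\<lambda>\<omega> i. X i \<omega>) -` ?E \<inter> space M = (\<Inter>j\<in>f ` ?K. X j -` F j \<inter> space M)"
        unfolding K(1) using False by (auto simp: E)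
      also have "prob \<dots> = (\<Prod>k\<in>?K. prob (X (f k) -` F (f k) \<inter> space M))"
        using False F sL K(1) unfolding INF_image comp_def by (intro indep_varsD[OF ind]) auto
      also have "\<dots> = (\<Prod>j\<in>J. prob (X j -` F j \<inter> space M))"
        by (subst K(1)[symmetric], subst prod.reindex[OF K(2)]) simp
      also have "\<dots> = (\<Prod>j\<in>J. measure (L j) (F j))"
        using F sL by (intro prod.cong) (auto simp: X(2) measure_distr simp flip: X(1))
      finally show ?thesis
        unfolding emeasure_eq_measure by (simp add: prod_ennreal L.M.emeasure_eq_measure)
    qed
    finally show "emeasure (distr M (PiM UNIV L) (\<lambda>\<omega> i. X i \<omega>)) ?E = (\<Prod>j\<in>J. emeasure (L j) (F j))" .
  qed simp
qed

lemma (in product_prob_space) nn_integral_PiM_prod: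
  assumes J: "finite J" "J \<subseteq> I" and g: "\<And>j. j \<in> J \<Longrightarrow> g j \<in> borel_measurable (M j)"
  shows "(\<integral>\<^sup>+\<omega>. (\<Prod>j\<in>J. g j (\<omega> j)) \<partial>PiM I M) = (\<Prod>j\<in>J. \<integral>\<^sup>+x. g j x \<partial>M j)"
proof -
  have meas: "(\<lambda>\<omega>. \<Prod>j\<in>J. g j (\<omega> j)) \<in> borel_measurable (PiM J M)"
    using g by (intro borel_measurable_prod_ennreal) (rule measurable_compose[OF measurable_component_singleton], auto)
  have "(\<integral>\<^sup>+\<omega>. (\<Prod>j\<in>J. g j (\<omega> j)) \<partial>PiM I M)
      = (\<integral>\<^sup>+\<omega>. (\<Prod>j\<in>J. g j (restrict \<omega> J j)) \<partial>PiM I M)"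
    by (intro nn_integral_cong prod.cong) auto
  also have "\<dots> = (\<integral>\<^sup>+\<omega>. (\<Prod>j\<in>J. g j (\<omega> j)) \<partial>distr (PiM I M) (PiM J M) (\<lambda>\<omega>. restrict \<omega> J))"
    using J meas by (intro nn_integral_distr[symmetric] measurable_restrict_subset) auto
  also have "\<dots> = (\<integral>\<^sup>+\<omega>. (\<Prod>j\<in>J. g j (\<omega> j)) \<partial>PiM J M)"
    using J by (subst distr_PiM_restrict_finite) auto
  also have "\<dots> = (\<Prod>j\<in>J. \<integral>\<^sup>+x. g j x \<partial>M j)"
    using J g by (intro product_nn_integral_prod) auto
  finally show ?thesis .
qed

text \<open>Meant for the two-sided walk, where moving the origin by one step alters the law of one
  coordinate. On boxes the density is seen by the factor \<open>i0\<close> alone.\<close>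

lemma (in product_prob_space) density_PiM_component:
  fixes f :: "'a \<Rightarrow> ennreal"
  assumes I: "I = UNIV"
    and f[measurable]: "f \<in> borel_measurable (M i0)" and ps: "prob_space (density (M i0) f)"
  shows "density (PiM UNIV M) (\<lambda>\<omega>. f (\<omega> i0)) = PiM UNIV (M(i0 := density (M i0) f))"
proof -
  let ?M = "M(i0 := density (M i0) f)"
  interpret N: product_prob_space ?M UNIV
    by (intro product_prob_spaceI) (auto simp: ps M.prob_space_axioms)
  have sets_eq: "sets (PiM UNIV ?M) = sets (PiM UNIV M)"
    by (intro sets_PiM_cong) auto
  show ?thesis
  proof (rule N.PiM_eq)
    show "sets (density (PiM UNIV M) (\<lambda>\<omega>. f (\<omega> i0))) = sets (PiM UNIV ?M)"
      by (simp add: sets_eq)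
    fix J F assume J: "finite J" "J \<subseteq> UNIV" and F: "\<And>j. j \<in> J \<Longrightarrow> F j \<in> sets (?M j)"
    have F': "F j \<in> sets (M j)" if "j \<in> J" for j using F[OF that] by (auto split: if_splits)
    \<comment> \<open>The density lives at \<open>i0\<close> even if the box leaves that coordinate
      free; a free coordinate is given the whole space.\<close>
    let ?K = "insert i0 J"
    define A where "A j = (if j \<in> J then F j else space (M j))" for j
    have A: "A j \<in> sets (M j)" for j using F' by (auto simp: A_def)
    let ?E = "prod_emb UNIV ?M J (\<Pi>\<^sub>E j\<in>J. F j)"
    have "?E \<in> sets (PiM UNIV ?M)" using J F by (intro sets_PiM_I) auto
    then have E: "?E \<in> sets (PiM UNIV M)" by (simp add: sets_eq)
    define g where "g j x = (if j = i0 then f x else 1) * indicator (A j) x" for j x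
    have g: "g j \<in> borel_measurable (M j)" for j
      using A unfolding g_def by (cases "j = i0") auto
    have "emeasure (density (PiM UNIV M) (\<lambda>\<omega>. f (\<omega> i0))) ?E =
        (\<integral>\<^sup>+\<omega>. f (\<omega> i0) * indicator ?E \<omega> \<partial>PiM UNIV M)"
      by (intro emeasure_density E) measurable
    also have "\<dots> = (\<integral>\<^sup>+\<omega>. (\<Prod>j\<in>?K. g j (\<omega> j)) \<partial>PiM UNIV M)"
    proof (intro nn_integral_cong)
      fix \<omega> assume \<omega>: "\<omega> \<in> space (PiM UNIV M)"
      have "\<omega> \<in> ?E \<longleftrightarrow> (\<forall>j\<in>?K. \<omega> j \<in> A j)"
        using \<omega> by (auto simp: prod_emb_def PiE_iff space_PiM A_def)
      moreover have "(\<Prod>j\<in>?K. indicator (A j) (\<omega> j)) = (if \<forall>j\<in>?K. \<omega> j \<in> A j then 1 else 0 :: ennreal)"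
      proof (cases "\<forall>j\<in>?K. \<omega> j \<in> A j")
        case True
        then show ?thesis by (simp add: prod.neutral)
      next
        case False
        then have "(\<Prod>j\<in>?K. indicator (A j) (\<omega> j)) = (0 :: ennreal)"
          using J(1) by (intro prod_zero) (auto simp: indicator_def)
        then show ?thesis by (simp only: if_not_P[OF False])
      qed
      moreover have "(\<Prod>j\<in>?K. g j (\<omega> j)) =
          (\<Prod>j\<in>?K. (if j = i0 then f (\<omega> j) else 1) * indicator (A j) (\<omega> j))"
        by (intro prod.cong) (auto simp: g_def)
      ultimately show "f (\<omega> i0) * indicator ?E \<omega> = (\<Prod>j\<in>?K. g j (\<omega> j))"
        using J(1) by (simp only: prod.distrib prod.delta finite_insert) (simp add: indicator_def)
    qed
    also have "\<dots> = (\<Prod>j\<in>?K. \<integral>\<^sup>+x. g j x \<partial>M j)"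
      using J(1) g unfolding I[symmetric] by (intro nn_integral_PiM_prod) (auto simp: I)
    also have "\<dots> = (\<Prod>j\<in>?K. emeasure (?M j) (A j))"
      using A by (intro prod.cong) (auto simp: g_def emeasure_density)
    also have "\<dots> = (\<Prod>j\<in>J. emeasure (?M j) (F j))"
    proof (cases "i0 \<in> J")
      case True
      then show ?thesis by (intro prod.cong) (auto simp: A_def)
    next
      case False
      then have "emeasure (?M i0) (A i0) = 1"
        using prob_space.emeasure_space_1[OF ps] by (simp add: A_def)
      with False J(1) show ?thesis
        by (simp add: A_def cong: prod.cong_simp)
    qed
    finally show "emeasure (density (PiM UNIV M) (\<lambda>\<omega>. f (\<omega> i0))) ?E = (\<Prod>j\<in>J. emeasure (?M j) (F j))" .
  qed
qed

section \<open>The renewal density of a Gaussian walk with drift\<close>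

text \<open>Continuity of the density yields some antiderivative \<open>F\<close>; integrating over
  intervals shows that the cdf has the same increments, so the two differ by a constant.\<close>

lemma DERIV_cdf_std_normal:
  "(cdf std_normal_distribution has_real_derivative std_normal_density x) (at x)"
proof -
  let ?\<Phi> = "cdf std_normal_distribution"
  interpret real_distribution std_normal_distribution
    by (rule real_dist_normal_dist)
  have cont: "isCont std_normal_density y" for y
    unfolding std_normal_density_def by (intro continuous_intros) auto
  obtain F where "\<forall>y. (F has_vector_derivative std_normal_density y) (at y)"
    using einterval_antiderivative[of "-\<infinity>" "\<infinity>" std_normal_density] cont by auto
  then have F: "(F has_real_derivative std_normal_density y) (at y)" for y
    by (simp add: has_real_derivative_iff_has_vector_derivative)
  have diff: "?\<Phi> b - ?\<Phi> a = F b - F a" if "a < b" for a b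
  proof -
    have "emeasure std_normal_distribution {a<..b} =
        (\<integral>\<^sup>+y. ennreal (std_normal_density y) * indicator {a<..b} y \<partial>lborel)"
      by (subst emeasure_density) auto
    also have "\<dots> = (\<integral>\<^sup>+y. ennreal (std_normal_density y) * indicator {a..b} y \<partial>lborel)"
      using AE_lborel_singleton[of a]
      by (intro nn_integral_cong_AE) (auto elim!: eventually_mono split: split_indicator)
    also have "\<dots> = ennreal (F b - F a)"
      using that F by (intro nn_integral_FTC_Icc) auto
    finally have "ennreal (measure std_normal_distribution {a<..b}) = ennreal (F b - F a)"
      by (simp add: emeasure_eq_measure)
    moreover have "F a \<le> F b"
      using that by (intro DERIV_nonneg_imp_nondecreasing[of a b F]) (auto intro: F)
    ultimately show ?thesis
      using cdf_diff_eq[OF that] by (simp add: measure_nonneg)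
  qed
  have eq: "?\<Phi> y = F y + (?\<Phi> 0 - F 0)" for y
    using diff[of 0 y] diff[of y 0] by (cases y "0 :: real" rule: linorder_cases) auto
  have "((\<lambda>y. F y + (?\<Phi> 0 - F 0)) has_real_derivative std_normal_density x) (at x)"
    using DERIV_add[OF F DERIV_const] by simp
  then show ?thesis
    by (subst DERIV_cong_ev[OF refl _ refl]) (rule always_eventually, rule allI, rule eq)
qed

section \<open>Riemann sums of unimodal functions\<close>

text \<open>Comparing each term with a mean value of \<open>F\<close> on the cell to its left costs at most \<open>\<eta>\<close> times
  the variation of \<open>F\<close> there, and the variation \<open>V\<close> of a unimodal function is at most \<open>2 F(p)\<close>.\<close>

lemma riemann_sum_unimodal:
  fixes F G :: "real \<Rightarrow> real"
  assumes \<eta>: "0 < \<eta>"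
    and contG: "continuous_on {0..} G" and G0: "G 0 = 0" and G1: "(G \<longlongrightarrow> 1) at_top"
    and DG: "\<And>s. 0 < s \<Longrightarrow> (G has_real_derivative F s) (at s)"
    and inc: "\<And>s t. 0 < s \<Longrightarrow> s \<le> t \<Longrightarrow> t \<le> p \<Longrightarrow> F s \<le> F t"
    and dec: "\<And>s t. 0 < s \<Longrightarrow> p \<le> s \<Longrightarrow> s \<le> t \<Longrightarrow> F t \<le> F s"
    and F0: "\<And>s. 0 < s \<Longrightarrow> 0 \<le> F s" and p: "0 < p"
  shows "summable (\<lambda>k. F (\<eta> * real (Suc k)))"
    and "\<bar>\<eta> * (\<Sum>k. F (\<eta> * real (Suc k))) - 1\<bar> \<le> 2 * \<eta> * F p"
proof -
  \<comment> \<open>The variation of \<open>F\<close> up to \<open>s\<close>, counting an initial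
    rise from 0: before the peak it is \<open>F s\<close>, after it the peak plus the loss
    \<open>F p - F s\<close>.\<close>
  define V where "V s = (if s \<le> 0 then 0 else if s \<le> p then F s else 2 * F p - F s)" for s
  have Fp: "F s \<le> F p" if "0 < s" for s
    using inc[of s p] dec[of p s] that p by (cases "s \<le> p") auto
  have V_bounds: "0 \<le> V s" "V s \<le> 2 * F p" for s
    using Fp[of s] F0[of s] F0[of p] p unfolding V_def by auto
  \<comment> \<open>Applied with \<open>r\<close> and \<open>t\<close> the ends of a cell and
    \<open>s\<close> a mean value point inside. The strict \<open>r < s\<close> admits
    \<open>r = 0\<close>, where nothing is known about \<open>F\<close>.\<close>
  have var: "\<bar>F t - F s\<bar> \<le> V t - V r" if "0 \<le> r" "r < s" "s \<le> t" for r s t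
  proof -
    have pos: "0 < s" "0 < t" using that by auto
    consider "t \<le> p" | "p < r" | "r \<le> p" "s \<le> p" "p < t" | "r \<le> p" "p < s" by linarith
    then show ?thesis
    proof cases
      case 1
      then have "V r \<le> F s" "F s \<le> F t" "V t = F t"
        using that pos inc[of r s] inc[of s t] F0[of s] by (auto simp: V_def)
      then show ?thesis by simp
    next
      case 2
      then have "V r = 2 * F p - F r" "F s \<le> F r" "F t \<le> F s" "V t = 2 * F p - F t"
        using that pos p dec[of r s] dec[of s t] by (auto simp: V_def)
      then show ?thesis by simp
    next
      case 3
      then have "V r \<le> F s" "V t = 2 * F p - F t"
        using that pos inc[of r s] F0[of s] by (auto simp: V_def)
      then show ?thesis using Fp[OF pos(1)] Fp[OF pos(2)] by simp
    next
      case 4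
      then have "V r \<le> F p" "F t \<le> F s" "V t = 2 * F p - F t"
        using that pos Fp[of r] F0[OF p] dec[of s t] by (auto simp: V_def)
      then show ?thesis using Fp[OF pos(1)] by simp
    qed
  qed
  let ?S = "\<lambda>n. \<Sum>k<n. F (\<eta> * real (Suc k))"
  \<comment> \<open>The increments of \<open>G\<close> and of \<open>V\<close> over the cells both
    telescope.\<close>
  have partial: "\<bar>\<eta> * ?S n - G (\<eta> * real n)\<bar> \<le> \<eta> * V (\<eta> * real n)" for n
  proof (induction n)
    case 0
    then show ?case by (simp add: G0 V_def)
  next
    case (Suc n)
    let ?a = "\<eta> * real n" and ?b = "\<eta> * real (Suc n)"
    have ab: "0 \<le> ?a" "?a < ?b" "?b - ?a = \<eta>" using \<eta> by (auto simp: algebra_simps)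
    have "\<exists>l z. ?a < z \<and> z < ?b \<and> DERIV G z :> l \<and> G ?b - G ?a = (?b - ?a) * l"
    proof (rule MVT[OF ab(2)])
      show "continuous_on {?a..?b} G"
        using contG by (rule continuous_on_subset) (use ab(1) in \<open>auto intro: order_trans\<close>)
      show "G differentiable at x" if "?a < x" "x < ?b" for x
        using DG[of x] that ab by (auto simp: real_differentiable_def)
    qed
    then obtain l z where z: "?a < z" "z < ?b" "DERIV G z :> l" "G ?b - G ?a = (?b - ?a) * l"
      by blast
    have "l = F z"
      using z(1,3) DG[of z] ab by (auto dest: DERIV_unique)
    then have "G ?b - G ?a = \<eta> * F z" using z(4) ab(3) by simp
    then have "\<bar>\<eta> * F ?b - (G ?b - G ?a)\<bar> = \<eta> * \<bar>F ?b - F z\<bar>"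
      using \<eta> by (simp add: abs_mult right_diff_distrib[symmetric])
    also have "\<dots> \<le> \<eta> * (V ?b - V ?a)"
      using var[of ?a z ?b] z ab \<eta> by (intro mult_left_mono) auto
    finally have "\<bar>\<eta> * F ?b - (G ?b - G ?a)\<bar> \<le> \<eta> * V ?b - \<eta> * V ?a"
      by (simp only: right_diff_distrib)
    moreover have "\<eta> * ?S (Suc n) = \<eta> * ?S n + \<eta> * F ?b"
      by (simp only: sum.lessThan_Suc distrib_left)
    ultimately show ?case using Suc.IH by linarith
  qed
  have Gle1: "G s \<le> 1" if "0 < s" for s
  proof (rule tendsto_lowerbound[OF G1])
    show "\<forall>\<^sub>F t in at_top. G s \<le> G t"
      using eventually_ge_at_top[of s]
    proof eventually_elim
      case (elim t)
      show ?case
        using elim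
      proof (rule DERIV_nonneg_imp_nondecreasing)
        show "\<exists>y. (G has_real_derivative y) (at r) \<and> 0 \<le> y" if "s \<le> r" for r
          using \<open>0 < s\<close> that by (intro exI[of _ "F r"] conjI DG F0) auto
      qed
    qed
  qed simp
  show sm: "summable (\<lambda>k. F (\<eta> * real (Suc k)))"
  proof (rule summableI_nonneg_bounded)
    show "0 \<le> F (\<eta> * real (Suc n))" for n
      using \<eta> by (intro F0) auto
    show "?S n \<le> (1 + 2 * \<eta> * F p) / \<eta>" for n
    proof (cases n)
      case 0
      then show ?thesis using \<eta> F0[OF p] by simp
    next
      case (Suc k)
      then have "0 < \<eta> * real n" using \<eta> by simp
      moreover have "\<eta> * V (\<eta> * real n) \<le> \<eta> * (2 * F p)"
        using \<eta> by (intro mult_left_mono V_bounds) auto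
      ultimately have "\<eta> * ?S n \<le> 1 + 2 * \<eta> * F p"
        using partial[of n] Gle1[of "\<eta> * real n"] by linarith
      then show ?thesis using \<eta> by (simp add: field_simps)
    qed
  qed
  have "(\<lambda>n. \<bar>\<eta> * ?S n - G (\<eta> * real n)\<bar>) \<longlonglongrightarrow> \<bar>\<eta> * (\<Sum>k. F (\<eta> * real (Suc k))) - 1\<bar>"
  proof (intro tendsto_intros)
    show "?S \<longlonglongrightarrow> (\<Sum>k. F (\<eta> * real (Suc k)))"
      using sm by (rule summable_LIMSEQ)
    have "filterlim (\<lambda>n. \<eta> * real n) at_top sequentially"
      using \<eta> by (intro filterlim_tendsto_pos_mult_at_top[OF tendsto_const _ filterlim_real_sequentially])
    then show "(\<lambda>n. G (\<eta> * real n)) \<longlonglongrightarrow> 1"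
      by (rule filterlim_compose[OF G1])
  qed
  then show "\<bar>\<eta> * (\<Sum>k. F (\<eta> * real (Suc k))) - 1\<bar> \<le> 2 * \<eta> * F p"
  proof (rule tendsto_upperbound)
    show "\<forall>\<^sub>F n in sequentially. \<bar>\<eta> * ?S n - G (\<eta> * real n)\<bar> \<le> 2 * \<eta> * F p"
    proof (intro always_eventually allI)
      fix n
      have "\<eta> * V (\<eta> * real n) \<le> \<eta> * (2 * F p)"
        using \<eta> by (intro mult_left_mono V_bounds) auto
      then show "\<bar>\<eta> * ?S n - G (\<eta> * real n)\<bar> \<le> 2 * \<eta> * F p"
        using partial[of n] by linarith
    qed
  qed simp
qed

text \<open>The density at \<open>x\<close> of sqrt 2 B(s) + s. Integrated over all s it is the
  potential density, or Green function, of this drifting motion.\<close>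

definition green :: "real \<Rightarrow> real \<Rightarrow> real" where
  "green x s = normal_density s (sqrt (2 * s)) x"

lemma green_eq: "0 < s \<Longrightarrow> green x s = exp (- (x - s)\<^sup>2 / (4 * s)) / sqrt (4 * pi * s)"
  by (simp add: green_def normal_density_def mult_ac)

text \<open>The antiderivative is the difference of the two terms whose sum is the law of the hitting time
  of level \<open>x\<close> by \<open>\<surd>2 B(s) + s\<close>.\<close>

definition green_prim :: "real \<Rightarrow> real \<Rightarrow> real" where
  "green_prim x s = (if s \<le> 0 then 0 else
     cdf std_normal_distribution ((s - x) / sqrt (2 * s))
     - exp x * cdf std_normal_distribution (- (s + x) / sqrt (2 * s)))"

lemma DERIV_green_prim:
  assumes "0 < s"
  shows "(green_prim x has_real_derivative green x s) (at s)"
proof -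
  let ?\<Phi> = "cdf std_normal_distribution"
  let ?u = "\<lambda>s. (s - x) / sqrt (2 * s)" and ?v = "\<lambda>s. - (s + x) / sqrt (2 * s)"
  define w where "w = sqrt (2 * s)"
  have w: "w > 0" "s = w\<^sup>2 / 2" using assms by (auto simp: w_def)
  have sq: "((\<lambda>s. sqrt (2 * s)) has_real_derivative 1 / w) (at s)"
    using assms by (auto intro!: derivative_eq_intros simp: w_def field_simps)
  have du: "(?u has_real_derivative (s + x) / (w * w\<^sup>2)) (at s)"
  proof (rule DERIV_cong)
    show "(?u has_real_derivative (1 * w - (s - x) * (1 / w)) / (w * w)) (at s)"
      unfolding w_def by (intro DERIV_divide sq[unfolded w_def])
        (use assms in \<open>auto intro!: derivative_eq_intros\<close>)
    show "(1 * w - (s - x) * (1 / w)) / (w * w) = (s + x) / (w * w\<^sup>2)"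
      using w(1) by (simp add: w(2) field_simps power2_eq_square)
  qed
  have dv: "(?v has_real_derivative - (s - x) / (w * w\<^sup>2)) (at s)"
  proof (rule DERIV_cong)
    show "(?v has_real_derivative ((- 1) * w - (- (s + x)) * (1 / w)) / (w * w)) (at s)"
      unfolding w_def by (intro DERIV_divide sq[unfolded w_def])
        (use assms in \<open>auto intro!: derivative_eq_intros\<close>)
    show "((- 1) * w - (- (s + x)) * (1 / w)) / (w * w) = - (s - x) / (w * w\<^sup>2)"
      using w(1) by (simp add: w(2) field_simps power2_eq_square)
  qed
  \<comment> \<open>The squares of the two arguments differ by 2x. This is what the factor
    \<open>exp x\<close> is for: both terms differentiate to multiples of one density, and the
    coefficients combine to 1/w.\<close>
  have e: "exp x * std_normal_density (?v s) = std_normal_density (?u s)"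
  proof -
    have "x + - (?v s)\<^sup>2 / 2 = - (?u s)\<^sup>2 / 2"
      using w(1) unfolding w_def[symmetric] by (simp add: w(2) field_simps power2_eq_square)
    then show ?thesis
      by (simp add: std_normal_density_def flip: exp_add)
  qed
  have "((\<lambda>s. ?\<Phi> (?u s) - exp x * ?\<Phi> (?v s)) has_real_derivative
      std_normal_density (?u s) * ((s + x) / (w * w\<^sup>2))
      - exp x * (std_normal_density (?v s) * (- (s - x) / (w * w\<^sup>2)))) (at s)"
    by (intro DERIV_diff DERIV_cmult DERIV_chain2[OF DERIV_cdf_std_normal] du dv)
  also have "std_normal_density (?u s) * ((s + x) / (w * w\<^sup>2))
      - exp x * (std_normal_density (?v s) * (- (s - x) / (w * w\<^sup>2)))
    = std_normal_density (?u s) * ((s + x) / (w * w\<^sup>2) + (s - x) / (w * w\<^sup>2))"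
    unfolding e[symmetric] by (simp add: algebra_simps add_divide_distrib diff_divide_distrib)
  also have "(s + x) / (w * w\<^sup>2) + (s - x) / (w * w\<^sup>2) = 1 / w"
    using w(1) by (simp add: w(2) field_simps power2_eq_square)
  also have "std_normal_density (?u s) * (1 / w) = green x s"
    using w(1) unfolding green_eq[OF assms] std_normal_density_def w_def
    using assms
    by (simp add: power_divide real_sqrt_mult power2_commute[of s x] field_simps)
  finally have "((\<lambda>s. ?\<Phi> (?u s) - exp x * ?\<Phi> (?v s)) has_real_derivative green x s) (at s)" .
  then show ?thesis
  proof (rule has_field_derivative_transform_within_open[of _ _ _ "{0<..}"])
    show "?\<Phi> (?u s) - exp x * ?\<Phi> (?v s) = green_prim x s" if "s \<in> {0<..}" for s
      using that by (simp add: green_prim_def)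
  qed (use assms in auto)
qed

text \<open>Only time 0 needs an argument: since x > 0, both normal arguments tend to minus infinity
  there, which matches the value 0 put in by hand.\<close>

lemma continuous_green_prim:
  assumes "0 < x"
  shows "continuous_on {0..} (green_prim x)"
proof -
  interpret real_distribution std_normal_distribution
    by (rule real_dist_normal_dist)
  let ?\<Phi> = "cdf std_normal_distribution"
  have "filterlim (\<lambda>s. (s - x) / sqrt (2 * s)) at_bot (at_right 0)"
    using assms by real_asymp
  then have 1: "((\<lambda>s. ?\<Phi> ((s - x) / sqrt (2 * s))) \<longlongrightarrow> 0) (at_right 0)"
    by (rule filterlim_compose[OF cdf_lim_at_bot])
  have "filterlim (\<lambda>s. - (s + x) / sqrt (2 * s)) at_bot (at_right 0)"
    using assms by real_asymp
  then have 2: "((\<lambda>s. ?\<Phi> (- (s + x) / sqrt (2 * s))) \<longlongrightarrow> 0) (at_right 0)"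
    by (rule filterlim_compose[OF cdf_lim_at_bot])
  have "((\<lambda>s. ?\<Phi> ((s - x) / sqrt (2 * s)) - exp x * ?\<Phi> (- (s + x) / sqrt (2 * s))) \<longlongrightarrow> 0 - exp x * 0) (at_right 0)"
    by (intro tendsto_intros 1 2)
  then have "(green_prim x \<longlongrightarrow> 0) (at_right 0)"
    by (rule Lim_transform_eventually[THEN tendsto_eq_rhs])
       (auto simp: green_prim_def eventually_at_filter)
  then have 0: "continuous (at 0 within {0..}) (green_prim x)"
    by (simp add: continuous_within green_prim_def at_within_Ici_at_right)
  show ?thesis
    unfolding continuous_on_eq_continuous_within
  proof
    fix s :: real assume "s \<in> {0..}"
    then consider "s = 0" | "0 < s" by force
    then show "continuous (at s within {0..}) (green_prim x)"
      using 0 by cases (auto intro!: continuous_at_imp_continuous_at_within DERIV_isCont DERIV_green_prim)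
  qed
qed

text \<open>The total mass over time is the reciprocal of the drift, here 1. It is the source of the
  limit 1/\<eta> on the grid.\<close>

lemma green_prim_at_top:
  assumes "0 < x"
  shows "(green_prim x \<longlongrightarrow> 1) at_top"
proof -
  interpret real_distribution std_normal_distribution
    by (rule real_dist_normal_dist)
  let ?\<Phi> = "cdf std_normal_distribution"
  have "filterlim (\<lambda>s. (s - x) / sqrt (2 * s)) at_top at_top"
    using assms by real_asymp
  then have 1: "((\<lambda>s. ?\<Phi> ((s - x) / sqrt (2 * s))) \<longlongrightarrow> 1) at_top"
    by (rule filterlim_compose[OF cdf_lim_at_top[unfolded prob_space]])
  have "filterlim (\<lambda>s. - (s + x) / sqrt (2 * s)) at_bot at_top"
    using assms by real_asymp
  then have 2: "((\<lambda>s. ?\<Phi> (- (s + x) / sqrt (2 * s))) \<longlongrightarrow> 0) at_top"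
    by (rule filterlim_compose[OF cdf_lim_at_bot])
  have "((\<lambda>s. ?\<Phi> ((s - x) / sqrt (2 * s)) - exp x * ?\<Phi> (- (s + x) / sqrt (2 * s))) \<longlongrightarrow> 1 - exp x * 0) at_top"
    by (intro tendsto_intros 1 2)
  then show ?thesis
    by (rule Lim_transform_eventually[THEN tendsto_eq_rhs])
       (auto simp: green_prim_def intro: eventually_mono[OF eventually_gt_at_top[of 0]])
qed

text \<open>The rational factor is the logarithmic derivative in time. For x > 0 its numerator
  changes sign once, from plus to minus, so \<open>green x\<close> is unimodal.\<close>

lemma DERIV_green:
  assumes "0 < s"
  shows "(green x has_real_derivative green x s * ((x\<^sup>2 - s\<^sup>2 - 2 * s) / (4 * s\<^sup>2))) (at s)"
proof -
  let ?g = "\<lambda>s. exp (- (x - s)\<^sup>2 / (4 * s)) / sqrt (4 * pi * s)"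
  define w where "w = sqrt (4 * pi * s)"
  have w: "0 < w" "w\<^sup>2 = 4 * pi * s" using assms by (auto simp: w_def)
  have w3: "w * w = 4 * (pi * s)" using w(2) by (simp add: power2_eq_square)
  have dw: "((\<lambda>s. sqrt (4 * pi * s)) has_real_derivative 2 * pi / w) (at s)"
  proof (rule DERIV_cong)
    show "((\<lambda>s. sqrt (4 * pi * s)) has_real_derivative inverse w / 2 * (4 * pi)) (at s)"
      unfolding w_def by (intro DERIV_chain2[OF DERIV_real_sqrt])
        (use assms in \<open>auto intro!: derivative_eq_intros\<close>)
  qed (simp add: field_simps)
  have de: "((\<lambda>s. - (x - s)\<^sup>2 / (4 * s)) has_real_derivative
      (2 * (x - s) * (4 * s) - (- (x - s)\<^sup>2) * 4) / (4 * s * (4 * s))) (at s)"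
    by (intro DERIV_divide) (use assms in \<open>auto intro!: derivative_eq_intros\<close>)
  have "(?g has_real_derivative ?g s * ((x\<^sup>2 - s\<^sup>2 - 2 * s) / (4 * s\<^sup>2))) (at s)"
  proof (rule DERIV_cong)
    let ?E = "exp (- (x - s)\<^sup>2 / (4 * s))"
    let ?d = "(2 * (x - s) * (4 * s) - (- (x - s)\<^sup>2) * 4) / (4 * s * (4 * s))"
    show "(?g has_real_derivative (?E * ?d * w - ?E * (2 * pi / w)) / (w * w)) (at s)"
      unfolding w_def by (intro DERIV_divide dw[unfolded w_def] DERIV_chain2[OF DERIV_exp] de)
        (use assms in auto)
    have split: "(A * w - 2 * pi / w) / (w * w) = A / w - 2 * pi / (w * w) / w" for A
      using w(1) by (simp add: field_simps)
    have "?d = (x\<^sup>2 - s\<^sup>2) / (4 * s\<^sup>2)"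
      using assms by (simp add: field_simps power2_eq_square)
    then have "(?E * ?d * w - ?E * (2 * pi / w)) / (w * w)
        = ?E * (((x\<^sup>2 - s\<^sup>2) / (4 * s\<^sup>2) * w - 2 * pi / w) / (w * w))"
      by (simp add: algebra_simps)
    also have "((x\<^sup>2 - s\<^sup>2) / (4 * s\<^sup>2) * w - 2 * pi / w) / (w * w)
        = (x\<^sup>2 - s\<^sup>2) / (4 * s\<^sup>2) / w - 2 * pi / (w * w) / w"
      by (rule split)
    also have "2 * pi / (w * w) = 2 * s / (4 * s\<^sup>2)"
      unfolding w3 using assms by (simp add: field_simps power2_eq_square)
    also have "?E * ((x\<^sup>2 - s\<^sup>2) / (4 * s\<^sup>2) / w - 2 * s / (4 * s\<^sup>2) / w)
        = ?E / w * ((x\<^sup>2 - s\<^sup>2 - 2 * s) / (4 * s\<^sup>2))"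
      by (simp add: diff_divide_distrib right_diff_distrib mult_ac)
    finally show "(?E * ?d * w - ?E * (2 * pi / w)) / (w * w)
        = ?g s * ((x\<^sup>2 - s\<^sup>2 - 2 * s) / (4 * s\<^sup>2))"
      unfolding w_def[symmetric] .
  qed
  then show ?thesis
    unfolding green_eq[OF assms, symmetric]
    by (rule has_field_derivative_transform_within_open[of _ _ _ "{0<..}"])
       (use assms in \<open>auto simp: green_eq\<close>)
qed

text \<open>The error of the Riemann sum is at most 2\<eta> times the height of the peak, which
  yields a rate and not only a limit.\<close>

lemma renewal_density_bound:
  assumes \<eta>: "0 < \<eta>" and x: "1 < x"
  shows "summable (\<lambda>k. green x (\<eta> * real (Suc k)))"
    and "\<bar>\<eta> * (\<Sum>k. green x (\<eta> * real (Suc k))) - 1\<bar> \<le> 2 * \<eta> / sqrt (4 * pi * (x - 1))"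
proof -
  \<comment> \<open>The positive root of x^2 - s^2 - 2s, that is, the time of the peak.\<close>
  define p where "p = sqrt (1 + x\<^sup>2) - 1"
  have p1: "(p + 1)\<^sup>2 = 1 + x\<^sup>2" by (simp add: p_def add_nonneg_nonneg)
  have px: "x - 1 < p"
    unfolding p_def by (simp add: real_less_rsqrt)
  then have p: "0 < p" using x by simp
  have pp: "x\<^sup>2 - s\<^sup>2 - 2 * s = (p + 1)\<^sup>2 - (s + 1)\<^sup>2" for s
    by (simp add: p1) (simp add: power2_eq_square algebra_simps)
  have inc: "green x s \<le> green x t" if "0 < s" "s \<le> t" "t \<le> p" for s t
  proof (rule DERIV_nonneg_imp_nondecreasing[OF that(2)])
    fix r assume r: "s \<le> r" "r \<le> t"
    have "(r + 1)\<^sup>2 \<le> (p + 1)\<^sup>2" using r that by (intro power_mono) auto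
    then have "0 \<le> green x r * ((x\<^sup>2 - r\<^sup>2 - 2 * r) / (4 * r\<^sup>2))"
      unfolding pp by (intro mult_nonneg_nonneg divide_nonneg_nonneg) (auto simp: green_def)
    then show "\<exists>y. (green x has_real_derivative y) (at r) \<and> 0 \<le> y"
      using DERIV_green[of r x] r that by auto
  qed
  have dec: "green x t \<le> green x s" if "0 < s" "p \<le> s" "s \<le> t" for s t
  proof (rule DERIV_nonpos_imp_nonincreasing[OF that(3)])
    fix r assume r: "s \<le> r" "r \<le> t"
    have "(p + 1)\<^sup>2 \<le> (r + 1)\<^sup>2" using r that p by (intro power_mono) auto
    then have "green x r * ((x\<^sup>2 - r\<^sup>2 - 2 * r) / (4 * r\<^sup>2)) \<le> 0"
      unfolding pp by (intro mult_nonneg_nonpos divide_nonpos_nonneg) (auto simp: green_def)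
    then show "\<exists>y. (green x has_real_derivative y) (at r) \<and> y \<le> 0"
      using DERIV_green[of r x] r that by auto
  qed
  note R = riemann_sum_unimodal[OF \<eta> continuous_green_prim _ green_prim_at_top DERIV_green_prim inc dec _ p]
  show "summable (\<lambda>k. green x (\<eta> * real (Suc k)))"
    by (rule R(1)) (use x in \<open>auto simp: green_prim_def green_def\<close>)
  have "\<bar>\<eta> * (\<Sum>k. green x (\<eta> * real (Suc k))) - 1\<bar> \<le> 2 * \<eta> * green x p"
    by (rule R(2)) (use x in \<open>auto simp: green_prim_def green_def\<close>)
  \<comment> \<open>The exponential is at most 1 and p exceeds x - 1.\<close>
  also have "green x p \<le> 1 / sqrt (4 * pi * (x - 1))"
    unfolding green_eq[OF p] using px x p by (intro frac_le) auto
  then have "2 * \<eta> * green x p \<le> 2 * \<eta> * (1 / sqrt (4 * pi * (x - 1)))"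
    using \<eta> by (intro mult_left_mono) auto
  finally show "\<bar>\<eta> * (\<Sum>k. green x (\<eta> * real (Suc k))) - 1\<bar> \<le> 2 * \<eta> / sqrt (4 * pi * (x - 1))"
    by simp
qed

section \<open>One-sided walks with negative drift\<close>

lemma normal_density_exp_tilt:
  assumes "0 < \<sigma>"
  shows "normal_density m \<sigma> x * exp (l * x)
    = exp (l * m + l\<^sup>2 * \<sigma>\<^sup>2 / 2) * normal_density (m + l * \<sigma>\<^sup>2) \<sigma> x"
proof -
  have "- (x - m)\<^sup>2 / (2 * \<sigma>\<^sup>2) + l * x = l * m + l\<^sup>2 * \<sigma>\<^sup>2 / 2 - (x - (m + l * \<sigma>\<^sup>2))\<^sup>2 / (2 * \<sigma>\<^sup>2)"
    using assms by (simp add: field_simps power2_eq_square)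
  then have "exp (- (x - m)\<^sup>2 / (2 * \<sigma>\<^sup>2)) * exp (l * x)
      = exp (l * m + l\<^sup>2 * \<sigma>\<^sup>2 / 2) * exp (- (x - (m + l * \<sigma>\<^sup>2))\<^sup>2 / (2 * \<sigma>\<^sup>2))"
    by (simp flip: exp_add)
  then show ?thesis
    by (simp add: normal_density_def)
qed

text \<open>Parametrised by the variance, which is linear in time along the walk, in contrast to
  \<open>normal_density\<close>.\<close>

definition gauss :: "real \<Rightarrow> real \<Rightarrow> real measure" where
  "gauss m v = density lborel (normal_density m (sqrt v))"

lemma sets_gauss [measurable_cong, simp]: "sets (gauss m v) = sets borel"
  and space_gauss [simp]: "space (gauss m v) = UNIV"
  by (simp_all add: gauss_def)

lemma prob_space_gauss: "0 < v \<Longrightarrow> prob_space (gauss m v)"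
  unfolding gauss_def by (rule prob_space_normal_density) simp

lemma nn_integral_gauss:
  "f \<in> borel_measurable borel \<Longrightarrow>
    (\<integral>\<^sup>+x. f x \<partial>gauss m v) = (\<integral>\<^sup>+x. ennreal (normal_density m (sqrt v) x) * f x \<partial>lborel)"
  unfolding gauss_def by (subst nn_integral_density) auto

lemma nn_integral_gauss_tilt:
  assumes v: "0 < v" and [measurable]: "f \<in> borel_measurable borel"
  shows "(\<integral>\<^sup>+x. ennreal (exp (l * x)) * f x \<partial>gauss m v)
    = ennreal (exp (l * m + l\<^sup>2 * v / 2)) * (\<integral>\<^sup>+x. f x \<partial>gauss (m + l * v) v)"
proof -
  have "(\<integral>\<^sup>+x. ennreal (exp (l * x)) * f x \<partial>gauss m v)
      = (\<integral>\<^sup>+x. ennreal (normal_density m (sqrt v) x * exp (l * x)) * f x \<partial>lborel)"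
    by (simp add: nn_integral_gauss ennreal_mult mult.assoc)
  also have "\<dots> = (\<integral>\<^sup>+x. ennreal (exp (l * m + l\<^sup>2 * v / 2)) *
      (ennreal (normal_density (m + l * v) (sqrt v) x) * f x) \<partial>lborel)"
    using v by (simp add: normal_density_exp_tilt ennreal_mult mult.assoc)
  finally show ?thesis
    by (simp add: nn_integral_gauss nn_integral_cmult)
qed

lemma nn_integral_gauss_exp:
  assumes "0 < v"
  shows "(\<integral>\<^sup>+x. ennreal (exp (l * x)) \<partial>gauss m v) = ennreal (exp (l * m + l\<^sup>2 * v / 2))"
proof -
  interpret prob_space "gauss (m + l * v) v" using assms by (rule prob_space_gauss)
  show ?thesis
    using nn_integral_gauss_tilt[OF assms, where f = "\<lambda>_. 1" and l = l and m = m] emeasure_space_1 by simp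
qed

text \<open>\<open>drift_seq \<eta>\<close> is the law of the steps of \<open>\<surd>2 B(t) - t\<close> along the grid of step \<open>\<eta>\<close>. With this
  normalisation the exponential of the walk is a martingale, and tilting by it turns the drift
  \<open>-\<eta>\<close> into \<open>\<eta>\<close>.\<close>

definition drift_seq :: "real \<Rightarrow> (nat \<Rightarrow> real) measure" where
  "drift_seq \<eta> = PiM UNIV (\<lambda>_. gauss (- \<eta>) (2 * \<eta>))"

definition walk :: "(nat \<Rightarrow> real) \<Rightarrow> nat \<Rightarrow> real" where
  "walk \<omega> n = (\<Sum>i<n. \<omega> i)"

lemma walk_0 [simp]: "walk \<omega> 0 = 0"
  by (simp add: walk_def)

lemma walk_case_nat [simp]: "walk (case_nat x \<omega>) (Suc n) = x + walk \<omega> n"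
  by (simp add: walk_def sum.lessThan_Suc_shift del: sum.lessThan_Suc)

lemma sets_drift_seq [measurable_cong, simp]: "sets (drift_seq \<eta>) = sets (PiM UNIV (\<lambda>_. borel))"
  by (auto simp: drift_seq_def intro!: sets_PiM_cong)

lemma space_drift_seq [simp]: "space (drift_seq \<eta>) = UNIV"
  by (simp add: drift_seq_def space_PiM)

lemma sets_PiM_Collect:
  assumes "Measurable.pred (PiM UNIV (\<lambda>_::'i. borel :: 'b :: topological_space measure)) P"
  shows "{\<omega>. P \<omega>} \<in> sets (PiM UNIV (\<lambda>_. borel))"
  using predE[OF assms] by (simp add: space_PiM)

lemma measurable_walk [measurable]: "(\<lambda>\<omega>. walk \<omega> n) \<in> borel_measurable (PiM UNIV (\<lambda>_. borel))"
  unfolding walk_def by measurable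

lemma prob_space_drift_seq: "0 < \<eta> \<Longrightarrow> prob_space (drift_seq \<eta>)"
  unfolding drift_seq_def by (intro prob_space_PiM prob_space_gauss) simp

lemma sequence_space_gauss: "0 < v \<Longrightarrow> sequence_space (gauss m v)"
  unfolding sequence_space_def by (intro product_prob_spaceI prob_space_gauss)

section \<open>Exceeding a level within finitely many steps\<close>

lemma sets_exceed: "{\<omega>. \<exists>k\<le>n. a < walk \<omega> k} \<in> sets (PiM UNIV (\<lambda>_. borel))"
  by (rule sets_PiM_Collect) measurable

text \<open>The finite horizon permits induction on \<open>n\<close> through the first step; an
  infinite horizon is reached by monotone limits.\<close>

definition exceed_prob :: "real \<Rightarrow> nat \<Rightarrow> real \<Rightarrow> ennreal" where
  "exceed_prob \<eta> n a = emeasure (drift_seq \<eta>) {\<omega>. \<exists>k\<le>n. a < walk \<omega> k}"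

lemma exceed_prob_neg: "0 < \<eta> \<Longrightarrow> a < 0 \<Longrightarrow> exceed_prob \<eta> n a = 1"
proof -
  assume "0 < \<eta>" "a < 0"
  then interpret prob_space "drift_seq \<eta>" by (intro prob_space_drift_seq)
  have "{\<omega>. \<exists>k\<le>n. a < walk \<omega> k} = space (drift_seq \<eta>)"
    using \<open>a < 0\<close> by (auto intro!: exI[of _ 0])
  then show ?thesis unfolding exceed_prob_def by (simp only: emeasure_space_1)
qed

text \<open>Conditioning on the first step. As the walk starts at 0, the hypothesis on
  \<open>a\<close> forces every exceedance time to be a successor.\<close>

lemma exceed_prob_Suc:
  assumes \<eta>: "0 < \<eta>" and a: "0 \<le> a"
  shows "exceed_prob \<eta> (Suc n) a = (\<integral>\<^sup>+x. exceed_prob \<eta> n (a - x) \<partial>gauss (- \<eta>) (2 * \<eta>))"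
proof -
  let ?M = "gauss (- \<eta>) (2 * \<eta>)"
  interpret sequence_space ?M using \<eta> by (intro sequence_space_gauss) simp
  interpret S: prob_space "drift_seq \<eta>" using \<eta> by (rule prob_space_drift_seq)
  have S: "S = drift_seq \<eta>" by (simp add: drift_seq_def)
  let ?A = "{\<omega>. \<exists>k\<le>Suc n. a < walk \<omega> k}"
  have A: "?A \<in> sets (drift_seq \<eta>)" by (simp add: sets_exceed)
  have iff: "case_nat x \<omega> \<in> ?A \<longleftrightarrow> \<omega> \<in> {\<omega>. \<exists>k\<le>n. a - x < walk \<omega> k}" for x \<omega>
  proof
    assume "case_nat x \<omega> \<in> ?A"
    then obtain k where k: "k \<le> Suc n" "a < walk (case_nat x \<omega>) k" by blast
    with a show "\<omega> \<in> {\<omega>. \<exists>k\<le>n. a - x < walk \<omega> k}"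
      by (cases k) (auto simp: algebra_simps)
  next
    assume "\<omega> \<in> {\<omega>. \<exists>k\<le>n. a - x < walk \<omega> k}"
    then obtain k where "k \<le> n" "a - x < walk \<omega> k" by blast
    then show "case_nat x \<omega> \<in> ?A"
      by (auto intro!: exI[of _ "Suc k"])
  qed
  have "exceed_prob \<eta> (Suc n) a = emeasure (distr (?M \<Otimes>\<^sub>M S) S (\<lambda>(s, \<omega>). case_nat s \<omega>)) ?A"
    unfolding PiM_iter by (simp add: exceed_prob_def drift_seq_def)
  also have "\<dots> = (\<integral>\<^sup>+z. indicator ?A (case_nat (fst z) (snd z)) \<partial>(?M \<Otimes>\<^sub>M S))"
    using A unfolding S
    by (subst nn_integral_indicator[symmetric], simp, subst nn_integral_distr) (simp_all add: case_prod_beta')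
  also have "\<dots> = (\<integral>\<^sup>+x. \<integral>\<^sup>+\<omega>. indicator ?A (case_nat x \<omega>) \<partial>S \<partial>?M)"
    using A unfolding S by (subst S.nn_integral_fst[symmetric]) simp_all
  also have "\<dots> = (\<integral>\<^sup>+x. exceed_prob \<eta> n (a - x) \<partial>?M)"
  proof (rule nn_integral_cong)
    fix x
    have "(\<integral>\<^sup>+\<omega>. indicator ?A (case_nat x \<omega>) \<partial>S) = (\<integral>\<^sup>+\<omega>. indicator {\<omega>. \<exists>k\<le>n. a - x < walk \<omega> k} \<omega> \<partial>S)"
      using iff by (intro nn_integral_cong) (simp add: indicator_def)
    then show "(\<integral>\<^sup>+\<omega>. indicator ?A (case_nat x \<omega>) \<partial>S) = exceed_prob \<eta> n (a - x)"
      unfolding S exceed_prob_def by (subst (asm) nn_integral_indicator) (simp_all add: sets_exceed)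
  qed
  finally show ?thesis .
qed

lemma measurable_exceed_prob [measurable]:
  assumes "0 < \<eta>"
  shows "exceed_prob \<eta> n \<in> borel_measurable borel"
proof -
  interpret S: prob_space "drift_seq \<eta>" using assms by (rule prob_space_drift_seq)
  have "(\<lambda>a. emeasure (drift_seq \<eta>) {\<omega>\<in>space (drift_seq \<eta>). \<exists>k\<le>n. a < walk \<omega> k}) \<in> borel_measurable borel"
    by measurable
  then show ?thesis by (simp add: exceed_prob_def[abs_def])
qed

text \<open>Doob's maximal inequality for the martingale \<open>exp (walk \<omega> n)\<close>, by
  induction: one step has exponential moment 1, so averaging over the first step preserves the
  bound. For negative \<open>a\<close> the bound exceeds 1.\<close>

lemma exceed_prob_le:
  assumes \<eta>: "0 < \<eta>"
  shows "exceed_prob \<eta> n a \<le> ennreal (exp (- a))"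
proof (induction n arbitrary: a)
  case 0
  interpret prob_space "drift_seq \<eta>" using \<eta> by (rule prob_space_drift_seq)
  show ?case
  proof (cases "a < 0")
    case False
    then show ?thesis by (simp add: exceed_prob_def)
  qed (use \<eta> in \<open>simp add: exceed_prob_neg ennreal_leI flip: ennreal_1\<close>)
next
  case (Suc n)
  show ?case
  proof (cases "a < 0")
    case True
    then show ?thesis using \<eta> by (simp add: exceed_prob_neg ennreal_leI flip: ennreal_1)
  next
    case False
    have "exceed_prob \<eta> (Suc n) a \<le> (\<integral>\<^sup>+x. ennreal (exp (- a)) * ennreal (exp (1 * x)) \<partial>gauss (- \<eta>) (2 * \<eta>))"
      using False \<eta> Suc[of "a - _"]
      by (subst exceed_prob_Suc) (auto intro!: nn_integral_mono simp: mult_exp_exp simp flip: ennreal_mult)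
    also have "\<dots> = ennreal (exp (- a))"
      using \<eta> by (subst nn_integral_cmult, simp, subst nn_integral_gauss_exp) auto
    finally show ?thesis .
  qed
qed

text \<open>Tilting turns \<open>e\<^sup>a\<close> times the probability into an expectation of \<open>e\<close> to minus the overshoot under
  the upward drift; the overshoot is at most \<open>\<epsilon>\<close> unless some step exceeds \<open>\<epsilon>\<close>.\<close>

lemma exceed_prob_ge:
  assumes \<eta>: "0 < \<eta>" and \<epsilon>: "0 \<le> \<epsilon>" and \<kappa>: "emeasure (gauss \<eta> (2 * \<eta>)) {\<epsilon><..} \<le> \<kappa>"
    and a: "- \<epsilon> \<le> a"
  shows "1 \<le> ennreal (exp (a + \<epsilon>)) * exceed_prob \<eta> n a + of_nat n * \<kappa>
    + ennreal (exp (a / 2 - real n * \<eta> / 4))"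
  using a
proof (induction n arbitrary: a)
  case 0
  show ?case
  proof (cases "a < 0")
    case True
    then have "1 \<le> ennreal (exp (a + \<epsilon>)) * exceed_prob \<eta> 0 a"
      using 0 \<eta> by (simp add: exceed_prob_neg)
    then show ?thesis by (simp add: add_increasing2)
  next
    case False
    then have "1 \<le> ennreal (exp (a / 2 - real 0 * \<eta> / 4))" by simp
    then show ?thesis by (simp add: add_increasing)
  qed
next
  case (Suc n)
  show ?case
  proof (cases "a < 0")
    case True
    then have "1 \<le> ennreal (exp (a + \<epsilon>)) * exceed_prob \<eta> (Suc n) a"
      using Suc \<eta> by (simp add: exceed_prob_neg)
    then show ?thesis by (simp add: add_increasing2)
  next
    case False
    let ?P = "gauss \<eta> (2 * \<eta>)" and ?M = "gauss (- \<eta>) (2 * \<eta>)"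
    interpret P: prob_space ?P using \<eta> by (intro prob_space_gauss) simp
    note [measurable] = measurable_exceed_prob[OF \<eta>]
    let ?f = "\<lambda>x. ennreal (exp (a - x + \<epsilon>)) * exceed_prob \<eta> n (a - x)"
    let ?g = "\<lambda>x. ennreal (exp ((a - x) / 2 - real n * \<eta> / 4))"
    have "1 = (\<integral>\<^sup>+x. 1 \<partial>?P)" using P.emeasure_space_1 by simp
    \<comment> \<open>A step beyond \<epsilon> is paid for by the indicator. Otherwise a - x is at
      least -\<epsilon>, which is the range of the induction hypothesis.\<close>
    also have "\<dots> \<le> (\<integral>\<^sup>+x. indicator {\<epsilon><..} x + (?f x + of_nat n * \<kappa> + ?g x) \<partial>?P)"
    proof (rule nn_integral_mono)
      fix x
      show "1 \<le> indicator {\<epsilon><..} x + (?f x + of_nat n * \<kappa> + ?g x)"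
        using Suc.IH[of "a - x"] False by (cases "x \<le> \<epsilon>") auto
    qed
    also have "\<dots> = emeasure ?P {\<epsilon><..} + ((\<integral>\<^sup>+x. ?f x \<partial>?P) + of_nat n * \<kappa> + (\<integral>\<^sup>+x. ?g x \<partial>?P))"
      using P.emeasure_space_1 by (simp add: nn_integral_add)
    also have "(\<integral>\<^sup>+x. ?f x \<partial>?P) = ennreal (exp (a + \<epsilon>)) * exceed_prob \<eta> (Suc n) a"
    proof -
      have "ennreal (exp (a + \<epsilon>)) * exceed_prob \<eta> (Suc n) a
          = ennreal (exp (a + \<epsilon>)) * (\<integral>\<^sup>+x. exceed_prob \<eta> n (a - x) \<partial>gauss (\<eta> + (- 1) * (2 * \<eta>)) (2 * \<eta>))"
        using \<eta> False by (subst exceed_prob_Suc) auto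
      \<comment> \<open>The tilt with l = -1 has normalising factor exp(-\<eta> + \<eta>) = 1 and
        turns the upward drift back into the downward one.\<close>
      also have "\<dots> = ennreal (exp (a + \<epsilon>)) * (\<integral>\<^sup>+x. ennreal (exp ((- 1) * x)) * exceed_prob \<eta> n (a - x) \<partial>?P)"
        using \<eta> by (subst nn_integral_gauss_tilt) auto
      also have "\<dots> = (\<integral>\<^sup>+x. ?f x \<partial>?P)"
        by (subst nn_integral_cmult[symmetric])
           (auto intro!: nn_integral_cong simp: mult.assoc[symmetric] mult_exp_exp algebra_simps simp flip: ennreal_mult)
      finally show ?thesis ..
    qed
    \<comment> \<open>This term is the Chernoff bound for the upward walk still being below
      \<open>a\<close> after \<open>n\<close> steps. The exponent -1/2 minimises the moment, at
      exp(-\<eta>/4) per step.\<close>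
    also have "(\<integral>\<^sup>+x. ?g x \<partial>?P) = (\<integral>\<^sup>+x. ennreal (exp (a / 2 - real n * \<eta> / 4)) * ennreal (exp ((- 1 / 2) * x)) \<partial>?P)"
      by (intro nn_integral_cong) (simp add: mult_exp_exp diff_divide_distrib algebra_simps flip: ennreal_mult)
    also have "\<dots> = ennreal (exp (a / 2 - real (Suc n) * \<eta> / 4))"
      using \<eta> by (subst nn_integral_cmult, simp, subst nn_integral_gauss_exp)
        (auto simp: mult_exp_exp field_simps power2_eq_square simp flip: ennreal_mult)
    also have "emeasure ?P {\<epsilon><..} + (ennreal (exp (a + \<epsilon>)) * exceed_prob \<eta> (Suc n) a + of_nat n * \<kappa>
          + ennreal (exp (a / 2 - real (Suc n) * \<eta> / 4)))
        \<le> \<kappa> + (ennreal (exp (a + \<epsilon>)) * exceed_prob \<eta> (Suc n) a + of_nat n * \<kappa>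
          + ennreal (exp (a / 2 - real (Suc n) * \<eta> / 4)))"
      using \<kappa> by (rule add_right_mono)
    finally show ?thesis by (simp add: algebra_simps)
  qed
qed

lemma gauss_tail:
  assumes \<eta>: "0 < \<eta>"
  shows "emeasure (gauss \<eta> (2 * \<eta>)) {\<epsilon><..} \<le> ennreal (exp (1 + sqrt \<eta> - \<epsilon> / sqrt \<eta>))"
proof -
  \<comment> \<open>A Chernoff bound at the scale of the step: the quadratic term becomes 1, and the
    decay exp(-\<epsilon>/sqrt \<eta>) still beats the number of steps per unit of time, of order
    1/\<eta>.\<close>
  define l where "l = 1 / sqrt \<eta>"
  have l: "0 < l" "l\<^sup>2 * \<eta> = 1" "l * \<eta> = sqrt \<eta>" using \<eta> by (auto simp: l_def power_divide real_div_sqrt)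
  have "emeasure (gauss \<eta> (2 * \<eta>)) {\<epsilon><..} = (\<integral>\<^sup>+x. indicator {\<epsilon><..} x \<partial>gauss \<eta> (2 * \<eta>))"
    by simp
  also have "\<dots> \<le> (\<integral>\<^sup>+x. ennreal (exp (- l * \<epsilon>)) * ennreal (exp (l * x)) \<partial>gauss \<eta> (2 * \<eta>))"
    using l(1) by (intro nn_integral_mono)
      (auto simp: mult_exp_exp indicator_def mult_left_mono simp flip: ennreal_mult)
  also have "\<dots> = ennreal (exp (1 + sqrt \<eta> - \<epsilon> / sqrt \<eta>))"
    using \<eta> l by (subst nn_integral_cmult, simp, subst nn_integral_gauss_exp)
      (auto simp: mult_exp_exp l_def simp flip: ennreal_mult)
  finally show ?thesis .
qed

section \<open>Last exit decomposition\<close>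

lemma emeasure_Collect:
  "{x. P x} \<in> sets M \<Longrightarrow> emeasure M {x. P x} = (\<integral>\<^sup>+x. of_bool (P x) \<partial>M)"
  using nn_integral_indicator[of "{x. P x}" M] by (simp add: indicator_def)

lemma borel_measurable_nn_integral_countable:
  fixes f :: "'i::countable \<Rightarrow> 'a \<Rightarrow> ennreal"
  assumes "\<And>k. f k \<in> borel_measurable M"
  shows "(\<lambda>x. \<integral>\<^sup>+k. f k x \<partial>count_space UNIV) \<in> borel_measurable M"
proof (rule sigma_finite_measure.borel_measurable_nn_integral)
  show "sigma_finite_measure (count_space (UNIV :: 'i set))"
    by (rule sigma_finite_measure_count_space_countable) simp
  show "(\<lambda>(x, k). f k x) \<in> borel_measurable (M \<Otimes>\<^sub>M count_space UNIV)"
    using measurable_compose_countable[of "\<lambda>k z. f k (fst z)" "M \<Otimes>\<^sub>M count_space UNIV" borel snd] assms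
    by (simp add: case_prod_beta')
qed

text \<open>Stated at \<open>Suc n\<close> because at time 0 the law is a point mass, which has no
  density.\<close>

lemma distr_walk:
  assumes \<eta>: "0 < \<eta>"
  shows "distr (drift_seq \<eta>) borel (\<lambda>\<omega>. walk \<omega> (Suc n)) = gauss (- (\<eta> * real (Suc n))) (2 * (\<eta> * real (Suc n)))"
proof -
  let ?M = "gauss (- \<eta>) (2 * \<eta>)"
  interpret sequence_space ?M using \<eta> by (intro sequence_space_gauss) simp
  interpret S: prob_space "drift_seq \<eta>" using \<eta> by (rule prob_space_drift_seq)
  have S: "S = drift_seq \<eta>" by (simp add: drift_seq_def)
  have comp: "distr (drift_seq \<eta>) borel (\<lambda>\<omega>. \<omega> i) = ?M" for i
  proof -
    have "distr (drift_seq \<eta>) borel (\<lambda>\<omega>. \<omega> i) = distr (drift_seq \<eta>) ?M (\<lambda>\<omega>. \<omega> i)"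
      by (rule distr_cong) simp_all
    then show ?thesis using PiM_component[of i] unfolding S by simp
  qed
  have "S.indep_vars (\<lambda>_. borel) (\<lambda>i \<omega>. \<omega> i) {..n}"
  proof (rule S.indep_vars_subset[of _ _ UNIV])
    have "distr (drift_seq \<eta>) (PiM UNIV (\<lambda>_. borel)) (\<lambda>x. \<lambda>i\<in>UNIV. x i) = drift_seq \<eta>"
      by (simp add: restrict_def distr_id2)
    then show "S.indep_vars (\<lambda>_. borel) (\<lambda>i \<omega>. \<omega> i) UNIV"
      by (subst S.indep_vars_iff_distr_eq_PiM) (simp_all add: comp, simp add: drift_seq_def)
  qed simp
  then have "distributed (drift_seq \<eta>) lborel (\<lambda>\<omega>. \<Sum>i\<in>{..n}. \<omega> i)
      (normal_density (\<Sum>i\<in>{..n}. - \<eta>) (sqrt (\<Sum>i\<in>{..n}. (sqrt (2 * \<eta>))\<^sup>2)))"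
    using \<eta> comp by (intro S.sum_indep_normal) (auto simp: distributed_def gauss_def cong: distr_cong)
  then show ?thesis
    using \<eta> by (simp add: distributed_def gauss_def walk_def lessThan_Suc_atMost algebra_simps cong: distr_cong)
qed

text \<open>Generic in the index type, so that the walks over nat and over int share it. A window
  has m + 1 points.\<close>

definition above :: "nat \<Rightarrow> ('i::linordered_semidom \<Rightarrow> real) \<Rightarrow> real \<Rightarrow> 'i \<Rightarrow> bool" where
  "above m w v k \<longleftrightarrow> (\<forall>j\<le>m. v < w (k + of_nat j))"

definition last_above :: "nat \<Rightarrow> ('i::linordered_semidom \<Rightarrow> real) \<Rightarrow> real \<Rightarrow> 'i \<Rightarrow> bool" where
  "last_above m w v k \<longleftrightarrow> above m w v k \<and> (\<forall>j>k. \<not> above m w v j)"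

lemma above_imp_less: "above m w v k \<Longrightarrow> v < w k"
  unfolding above_def by (metis add_0_right le0 of_nat_0)

text \<open>A nonempty finite set of starting points has exactly one maximum, so the count is 1.
  With infinitely many windows there might be no last one.\<close>

lemma nn_integral_last_above:
  fixes w :: "'i::linordered_semidom \<Rightarrow> real"
  assumes "finite {k. v < w k}"
  shows "(\<integral>\<^sup>+k. of_bool (last_above m w v k) \<partial>count_space UNIV) = (of_bool (\<exists>k. above m w v k) :: ennreal)"
proof (cases "\<exists>k. above m w v k")
  case True
  let ?A = "{k. above m w v k}"
  have fin: "finite ?A" using assms by (rule rev_finite_subset) (auto dest: above_imp_less)
  have "last_above m w v k \<longleftrightarrow> k = Max ?A" for k
  proof
    assume "last_above m w v k"
    then show "k = Max ?A"
      using fin unfolding last_above_def by (intro Max_eqI[symmetric]) (auto simp: not_less[symmetric])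
  next
    have "Max ?A \<in> ?A" using fin True by (intro Max_in) auto
    moreover assume "k = Max ?A"
    ultimately show "last_above m w v k"
      using Max_ge[OF fin] unfolding last_above_def by (auto simp: not_le[symmetric])
  qed
  then have "(\<integral>\<^sup>+k. of_bool (last_above m w v k) \<partial>count_space UNIV)
      = (\<integral>\<^sup>+k. indicator {Max ?A} k \<partial>count_space UNIV)"
    by (intro nn_integral_cong) (auto simp: indicator_def)
  then show ?thesis using True by simp
next
  case False
  then show ?thesis by (simp add: last_above_def)
qed

text \<open>Markov's inequality for counting measure. Half the exponent is taken because
  \<open>exp (walk \<omega> k)\<close> has mean 1 for every \<open>k\<close>, whereas the mean of
  its square root decays geometrically.\<close>

lemma finite_exceed_of_summable_exp:
  fixes w :: "'i \<Rightarrow> real"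
  assumes "(\<integral>\<^sup>+k. ennreal (exp (w k / 2)) \<partial>count_space UNIV) \<noteq> \<infinity>"
  shows "finite {k. v < w k}"
proof (rule ccontr)
  assume inf: "infinite {k. v < w k}"
  have "\<infinity> = ennreal (exp (v / 2)) * emeasure (count_space UNIV) {k. v < w k}"
    using inf by (simp add: ennreal_mult_top)
  also have "\<dots> = (\<integral>\<^sup>+k. ennreal (exp (v / 2)) * indicator {k. v < w k} k \<partial>count_space UNIV)"
    by (simp add: nn_integral_cmult)
  also have "\<dots> \<le> (\<integral>\<^sup>+k. ennreal (exp (w k / 2)) \<partial>count_space UNIV)"
    by (intro nn_integral_mono) (auto simp: indicator_def intro!: ennreal_leI)
  finally show False using assms by (simp add: top_unique)
qed

lemma AE_summable_exp:
  fixes w :: "'a \<Rightarrow> 'i::countable \<Rightarrow> real"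
  assumes [measurable]: "\<And>k. (\<lambda>\<omega>. w \<omega> k) \<in> borel_measurable M"
    and fin: "(\<integral>\<^sup>+k. (\<integral>\<^sup>+\<omega>. ennreal (exp (w \<omega> k / 2)) \<partial>M) \<partial>count_space UNIV) < \<infinity>"
  shows "AE \<omega> in M. (\<integral>\<^sup>+k. ennreal (exp (w \<omega> k / 2)) \<partial>count_space UNIV) \<noteq> \<infinity>"
proof (rule nn_integral_PInf_AE)
  show "(\<lambda>\<omega>. \<integral>\<^sup>+k. ennreal (exp (w \<omega> k / 2)) \<partial>count_space UNIV) \<in> borel_measurable M"
    by (rule borel_measurable_nn_integral_countable) auto
  show "(\<integral>\<^sup>+\<omega>. (\<integral>\<^sup>+k. ennreal (exp (w \<omega> k / 2)) \<partial>count_space UNIV) \<partial>M) \<noteq> \<infinity>"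
    using fin by (subst nn_integral_count_space_nn_integral) auto
qed

lemma AE_walk_finite:
  assumes \<eta>: "0 < \<eta>"
  shows "AE \<omega> in drift_seq \<eta>. \<forall>v. finite {k. v < walk \<omega> k}"
proof -
  let ?M = "gauss (- \<eta>) (2 * \<eta>)"
  interpret sequence_space ?M using \<eta> by (intro sequence_space_gauss) simp
  have "(\<integral>\<^sup>+\<omega>. ennreal (exp (walk \<omega> k / 2)) \<partial>drift_seq \<eta>) = ennreal (exp (- (\<eta> / 4)) ^ k)" for k
  proof -
    have "(\<integral>\<^sup>+\<omega>. ennreal (exp (walk \<omega> k / 2)) \<partial>drift_seq \<eta>)
        = (\<integral>\<^sup>+\<omega>. (\<Prod>j<k. ennreal (exp ((1 / 2) * \<omega> j))) \<partial>drift_seq \<eta>)"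
      by (intro nn_integral_cong) (simp add: walk_def sum_divide_distrib exp_sum prod_ennreal)
    also have "\<dots> = (\<Prod>j<k. \<integral>\<^sup>+x. ennreal (exp ((1 / 2) * x)) \<partial>?M)"
      unfolding drift_seq_def by (rule nn_integral_PiM_prod) auto
    also have "\<dots> = (\<Prod>j<k. ennreal (exp (- (\<eta> / 4))))"
      using \<eta> by (subst nn_integral_gauss_exp) (auto simp: power2_eq_square)
    finally show ?thesis by (simp add: ennreal_power)
  qed
  moreover have "(\<Sum>k. ennreal (exp (- (\<eta> / 4)) ^ k)) < \<infinity>"
    using \<eta> by (subst suminf_ennreal2) (auto intro!: summable_geometric)
  ultimately have "AE \<omega> in drift_seq \<eta>. (\<integral>\<^sup>+k. ennreal (exp (walk \<omega> k / 2)) \<partial>count_space UNIV) \<noteq> \<infinity>"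
    by (intro AE_summable_exp) (auto simp: nn_integral_count_space_nat)
  then show ?thesis
    by eventually_elim (auto intro: finite_exceed_of_summable_exp)
qed

section \<open>The last-exit formula for the one-sided walk\<close>

definition parisian_prob :: "real \<Rightarrow> nat \<Rightarrow> real \<Rightarrow> ennreal" where
  "parisian_prob \<eta> m a = emeasure (drift_seq \<eta>) {\<omega>. \<exists>k. above m (walk \<omega>) a k}"

definition last_prob :: "real \<Rightarrow> nat \<Rightarrow> real \<Rightarrow> ennreal" where
  "last_prob \<eta> m v = emeasure (drift_seq \<eta>) {\<omega>. last_above m (walk \<omega>) v 0}"

lemma pred_above_walk [measurable]:
  assumes [measurable]: "f \<in> measurable M (PiM UNIV (\<lambda>_. borel))" "g \<in> borel_measurable M"
  shows "Measurable.pred M (\<lambda>x. above m (walk (f x)) (g x) k)"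
  unfolding above_def by measurable

lemma pred_last_above_walk [measurable]:
  assumes [measurable]: "f \<in> measurable M (PiM UNIV (\<lambda>_. borel))" "g \<in> borel_measurable M"
  shows "Measurable.pred M (\<lambda>x. last_above m (walk (f x)) (g x) k)"
  unfolding last_above_def by measurable

lemma walk_comb_seq [simp]: "walk (comb_seq n \<omega> \<omega>') (n + i) = walk \<omega> n + walk \<omega>' i"
proof (induction i)
  case 0
  then show ?case by (simp add: walk_def comb_seq_def)
next
  case (Suc i)
  then show ?case by (simp add: walk_def comb_seq_def)
qed

text \<open>Windows starting at \<open>n\<close> or later see the past only through the value of the
  walk at \<open>n\<close>, by which the level is lowered.\<close>

lemma last_above_comb_seq:
  "last_above m (walk (comb_seq n \<omega> \<omega>')) a n \<longleftrightarrow> last_above m (walk \<omega>') (a - walk \<omega> n) 0"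
proof -
  have *: "above m (walk (comb_seq n \<omega> \<omega>')) a (n + k) \<longleftrightarrow> above m (walk \<omega>') (a - walk \<omega> n) k" for k
  proof -
    have "a < x + y \<longleftrightarrow> a - x < y" for x y by auto
    then show ?thesis by (simp add: above_def add.assoc)
  qed
  have "(\<forall>j>n. \<not> above m (walk (comb_seq n \<omega> \<omega>')) a j) \<longleftrightarrow> (\<forall>k>0. \<not> above m (walk (comb_seq n \<omega> \<omega>')) a (n + k))"
    by (metis less_add_same_cancel1 less_imp_add_positive)
  then show ?thesis
    using *[of 0] unfolding last_above_def by (simp add: *)
qed

lemma measurable_last_prob [measurable]:
  assumes "0 < \<eta>"
  shows "last_prob \<eta> m \<in> borel_measurable borel"
proof -
  interpret S: prob_space "drift_seq \<eta>" using assms by (rule prob_space_drift_seq)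
  have "(\<lambda>v. emeasure (drift_seq \<eta>) {\<omega>\<in>space (drift_seq \<eta>). last_above m (walk \<omega>) v 0}) \<in> borel_measurable borel"
    by measurable
  then show ?thesis by (simp add: last_prob_def[abs_def])
qed

text \<open>The Markov property at a fixed time: the product law is invariant under splicing two
  independent copies at time \<open>n\<close>.\<close>

lemma emeasure_last_above:
  assumes \<eta>: "0 < \<eta>"
  shows "emeasure (drift_seq \<eta>) {\<omega>. last_above m (walk \<omega>) a n}
    = (\<integral>\<^sup>+\<omega>. last_prob \<eta> m (a - walk \<omega> n) \<partial>drift_seq \<eta>)"
proof -
  let ?M = "gauss (- \<eta>) (2 * \<eta>)"
  interpret sequence_space ?M using \<eta> by (intro sequence_space_gauss) simp
  interpret S: prob_space "drift_seq \<eta>" using \<eta> by (rule prob_space_drift_seq)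
  have S: "S = drift_seq \<eta>" by (simp add: drift_seq_def)
  have sets: "{\<omega>. last_above m (walk \<omega>) v n} \<in> sets (PiM UNIV (\<lambda>_. borel))" for v n
    by (rule sets_PiM_Collect) measurable
  let ?A = "{\<omega>. last_above m (walk \<omega>) a n}"
  have A: "?A \<in> sets (drift_seq \<eta>)" by (simp add: sets)
  have "emeasure (drift_seq \<eta>) ?A = emeasure (distr (S \<Otimes>\<^sub>M S) S (\<lambda>(\<omega>, \<omega>'). comb_seq n \<omega> \<omega>')) ?A"
    unfolding PiM_comb_seq by (simp add: drift_seq_def)
  also have "\<dots> = (\<integral>\<^sup>+z. indicator ?A (comb_seq n (fst z) (snd z)) \<partial>(S \<Otimes>\<^sub>M S))"
    using A unfolding S
    by (subst nn_integral_indicator[symmetric], simp, subst nn_integral_distr) (simp_all add: case_prod_beta')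
  also have "\<dots> = (\<integral>\<^sup>+\<omega>. \<integral>\<^sup>+\<omega>'. indicator ?A (comb_seq n \<omega> \<omega>') \<partial>S \<partial>S)"
    using A unfolding S by (subst S.nn_integral_fst[symmetric]) simp_all
  also have "\<dots> = (\<integral>\<^sup>+\<omega>. last_prob \<eta> m (a - walk \<omega> n) \<partial>S)"
  proof (rule nn_integral_cong)
    fix \<omega>
    have "(\<integral>\<^sup>+\<omega>'. indicator ?A (comb_seq n \<omega> \<omega>') \<partial>S)
        = (\<integral>\<^sup>+\<omega>'. indicator {\<omega>'. last_above m (walk \<omega>') (a - walk \<omega> n) 0} \<omega>' \<partial>S)"
      by (intro nn_integral_cong) (simp add: indicator_def last_above_comb_seq)
    then show "(\<integral>\<^sup>+\<omega>'. indicator ?A (comb_seq n \<omega> \<omega>') \<partial>S) = last_prob \<eta> m (a - walk \<omega> n)"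
      unfolding S last_prob_def by (subst (asm) nn_integral_indicator) (simp_all add: sets)
  qed
  finally show ?thesis unfolding S .
qed

lemma parisian_prob_last_exit:
  assumes \<eta>: "0 < \<eta>" and a: "0 \<le> a"
  shows "ennreal (exp a) * parisian_prob \<eta> m a
    = (\<integral>\<^sup>+v. ennreal (exp v) * last_prob \<eta> m v * (\<Sum>k. ennreal (green (a - v) (\<eta> * real (Suc k)))) \<partial>lborel)"
proof -
  interpret S: prob_space "drift_seq \<eta>" using \<eta> by (rule prob_space_drift_seq)
  note [measurable] = measurable_last_prob[OF \<eta>]
  have sets: "{\<omega>. last_above m (walk \<omega>) v n} \<in> sets (PiM UNIV (\<lambda>_. borel))" for v n
    by (rule sets_PiM_Collect) measurable
  have sets': "{\<omega>. \<exists>k. above m (walk \<omega>) a k} \<in> sets (PiM UNIV (\<lambda>_. borel))"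
    by (rule sets_PiM_Collect) measurable
  \<comment> \<open>The walk starts at 0, which is not above \<open>a\<close>; only times at which
    the walk has a density remain.\<close>
  have not0: "\<not> last_above m (walk \<omega>) a 0" for \<omega>
    using a above_imp_less[of m "walk \<omega>" a 0] by (auto simp: last_above_def)
  \<comment> \<open>The tilt with l = 1 has factor exp(-s + s) = 1 and reverses the drift. It leaves
    exp(a - x), the weight of the level a - x at which the future is evaluated.\<close>
  have green: "exp a * normal_density (- s) (sqrt (2 * s)) x = exp (a - x) * green x s" if "0 < s" for s x
    using normal_density_exp_tilt[of "sqrt (2 * s)" "- s" x 1] that
    by (simp add: green_def exp_diff field_simps)
  have "parisian_prob \<eta> m a = (\<integral>\<^sup>+\<omega>. of_bool (\<exists>k. above m (walk \<omega>) a k) \<partial>drift_seq \<eta>)"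
    unfolding parisian_prob_def using sets' by (intro emeasure_Collect) simp
  also have "\<dots> = (\<integral>\<^sup>+\<omega>. (\<integral>\<^sup>+k. of_bool (last_above m (walk \<omega>) a k) \<partial>count_space UNIV) \<partial>drift_seq \<eta>)"
    using AE_walk_finite[OF \<eta>] by (intro nn_integral_cong_AE) (auto simp: nn_integral_last_above)
  also have "\<dots> = (\<Sum>k. emeasure (drift_seq \<eta>) {\<omega>. last_above m (walk \<omega>) a k})"
    using sets by (subst nn_integral_count_space_nn_integral)
      (auto simp: nn_integral_count_space_nat emeasure_Collect)
  also have "\<dots> = (\<Sum>k. emeasure (drift_seq \<eta>) {\<omega>. last_above m (walk \<omega>) a (Suc k)})"
    by (subst suminf_offset[where i = 1]) (auto simp: not0 summableI)
  also have "\<dots> = (\<Sum>k. \<integral>\<^sup>+x. last_prob \<eta> m (a - x) \<partial>gauss (- (\<eta> * real (Suc k))) (2 * (\<eta> * real (Suc k))))"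
    by (simp only: emeasure_last_above[OF \<eta>] distr_walk[OF \<eta>, symmetric])
       (intro suminf_cong, subst nn_integral_distr, auto)
  finally have "ennreal (exp a) * parisian_prob \<eta> m a
      = (\<Sum>k. ennreal (exp a) * (\<integral>\<^sup>+x. last_prob \<eta> m (a - x) \<partial>gauss (- (\<eta> * real (Suc k))) (2 * (\<eta> * real (Suc k)))))"
    by simp
  also have "\<dots> = (\<Sum>k. \<integral>\<^sup>+v. ennreal (exp v) * last_prob \<eta> m v * ennreal (green (a - v) (\<eta> * real (Suc k))) \<partial>lborel)"
  proof (rule suminf_cong)
    fix k
    let ?s = "\<eta> * real (Suc k)"
    have s: "0 < ?s" using \<eta> by simp
    have "ennreal (exp a) * (\<integral>\<^sup>+x. last_prob \<eta> m (a - x) \<partial>gauss (- ?s) (2 * ?s))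
        = (\<integral>\<^sup>+x. ennreal (exp a * normal_density (- ?s) (sqrt (2 * ?s)) x) * last_prob \<eta> m (a - x) \<partial>lborel)"
      by (simp add: nn_integral_gauss nn_integral_cmult[symmetric] ennreal_mult mult.assoc)
    also have "\<dots> = (\<integral>\<^sup>+x. ennreal (exp (a - x)) * last_prob \<eta> m (a - x) * ennreal (green x ?s) \<partial>lborel)"
      unfolding green[OF s] by (intro nn_integral_cong) (simp add: ennreal_mult green_def mult_ac)
    also have "\<dots> = (\<integral>\<^sup>+v. ennreal (exp v) * last_prob \<eta> m v * ennreal (green (a - v) ?s) \<partial>lborel)"
      by (subst nn_integral_real_affine[where c = "- 1" and t = a]) (auto simp: green_def)
    finally show "ennreal (exp a) * (\<integral>\<^sup>+x. last_prob \<eta> m (a - x) \<partial>gauss (- ?s) (2 * ?s))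
        = (\<integral>\<^sup>+v. ennreal (exp v) * last_prob \<eta> m v * ennreal (green (a - v) ?s) \<partial>lborel)" .
  qed
  also have "\<dots> = (\<integral>\<^sup>+v. (\<Sum>k. ennreal (exp v) * last_prob \<eta> m v * ennreal (green (a - v) (\<eta> * real (Suc k)))) \<partial>lborel)"
    by (subst nn_integral_suminf) (auto simp: green_def)
  finally show ?thesis by simp
qed

text \<open>The layer-cake formula with exponential weight; it later converts a measure of levels
  into the supremum of the exponential walk.\<close>

lemma nn_integral_exp_less:
  "(\<integral>\<^sup>+v. ennreal (exp v) * of_bool (v < y) \<partial>lborel) = ennreal (exp y)"
proof -
  have lim: "((\<lambda>x. - exp (y - x)) \<longlongrightarrow> 0) at_top"
    by real_asymp
  have "(\<integral>\<^sup>+v. ennreal (exp v) * of_bool (v < y) \<partial>lborel)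
      = (\<integral>\<^sup>+x. ennreal (exp (y - x)) * of_bool (0 < x) \<partial>lborel)"
    by (subst nn_integral_real_affine[where c = "- 1" and t = y]) auto
  also have "\<dots> = (\<integral>\<^sup>+x. ennreal (exp (y - x)) * indicator {0..} x \<partial>lborel)"
    using AE_lborel_singleton[of 0]
    by (intro nn_integral_cong_AE) (auto elim!: eventually_mono simp: indicator_def)
  also have "\<dots> = ennreal (0 - (- exp (y - 0)))"
    by (rule nn_integral_FTC_atLeast[OF _ _ _ lim]) (auto intro!: derivative_eq_intros)
  finally show ?thesis by simp
qed

section \<open>Asymptotics for the one-sided walk\<close>

definition last_mass :: "real \<Rightarrow> nat \<Rightarrow> ennreal" where
  "last_mass \<eta> m = (\<integral>\<^sup>+v. ennreal (exp v) * last_prob \<eta> m v \<partial>lborel)"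

lemma last_prob_nonneg_eq_0: "0 \<le> v \<Longrightarrow> last_prob \<eta> m v = 0"
proof -
  assume "0 \<le> v"
  then have "{\<omega>. last_above m (walk \<omega>) v 0} = {}"
    using above_imp_less[of m "walk _" v 0] by (auto simp: last_above_def)
  then show ?thesis by (simp only: last_prob_def emeasure_empty)
qed

lemma last_mass_le_1:
  assumes "0 < \<eta>"
  shows "last_mass \<eta> m \<le> 1"
proof -
  interpret S: prob_space "drift_seq \<eta>" using assms by (rule prob_space_drift_seq)
  have "last_mass \<eta> m \<le> (\<integral>\<^sup>+v. ennreal (exp v) * of_bool (v < 0) \<partial>lborel)"
    unfolding last_mass_def
  proof (rule nn_integral_mono)
    fix v
    show "ennreal (exp v) * last_prob \<eta> m v \<le> ennreal (exp v) * of_bool (v < 0)"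
    proof (cases "v < 0")
      case True
      have "last_prob \<eta> m v \<le> 1" by (simp add: last_prob_def S.emeasure_le_1)
      from mult_left_mono[OF this, of "ennreal (exp v)"] True show ?thesis by simp
    qed (simp add: last_prob_nonneg_eq_0)
  qed
  then show ?thesis by (simp add: nn_integral_exp_less)
qed

text \<open>Mass sits only on levels v < 0, where a - v > a. The renewal bound at \<open>a\<close>
  therefore holds for all of them and can be integrated.\<close>

lemma parisian_prob_bounds:
  assumes \<eta>: "0 < \<eta>" and a: "2 \<le> a"
  defines "e \<equiv> 2 * \<eta> / sqrt (4 * pi * (a - 1))"
  shows "ennreal ((1 - e) / \<eta>) * last_mass \<eta> m \<le> ennreal (exp a) * parisian_prob \<eta> m a"
    and "ennreal (exp a) * parisian_prob \<eta> m a \<le> ennreal ((1 + e) / \<eta>) * last_mass \<eta> m"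
proof -
  note [measurable] = measurable_last_prob[OF \<eta>]
  let ?r = "\<lambda>v. \<Sum>k. ennreal (green (a - v) (\<eta> * real (Suc k)))"
  have eq: "ennreal (exp a) * parisian_prob \<eta> m a = (\<integral>\<^sup>+v. ennreal (exp v) * last_prob \<eta> m v * ?r v \<partial>lborel)"
    using \<eta> a by (intro parisian_prob_last_exit) auto
  have r: "ennreal ((1 - e) / \<eta>) \<le> ?r v" "?r v \<le> ennreal ((1 + e) / \<eta>)" if "v < 0" for v
  proof -
    have x: "1 < a - v" using a that by simp
    note R = renewal_density_bound[OF \<eta> x]
    let ?s = "\<Sum>k. green (a - v) (\<eta> * real (Suc k))"
    have "2 * \<eta> / sqrt (4 * pi * (a - v - 1)) \<le> e"
      unfolding e_def using \<eta> a that by (intro divide_left_mono) auto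
    then have "\<bar>\<eta> * ?s - 1\<bar> \<le> e" using R(2) by linarith
    then have "(1 - e) / \<eta> \<le> ?s" "?s \<le> (1 + e) / \<eta>"
      using \<eta> by (auto simp: field_simps abs_le_iff)
    moreover have "?r v = ennreal ?s"
      using R(1) by (intro suminf_ennreal2) (auto simp: green_def)
    ultimately show "ennreal ((1 - e) / \<eta>) \<le> ?r v" "?r v \<le> ennreal ((1 + e) / \<eta>)"
      by (auto intro!: ennreal_leI)
  qed
  have lm: "ennreal c * last_mass \<eta> m = (\<integral>\<^sup>+v. ennreal (exp v) * last_prob \<eta> m v * ennreal c \<partial>lborel)" for c
    unfolding last_mass_def by (simp add: nn_integral_multc mult.commute[of "ennreal c"])
  show "ennreal ((1 - e) / \<eta>) * last_mass \<eta> m \<le> ennreal (exp a) * parisian_prob \<eta> m a"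
    unfolding eq lm
  proof (rule nn_integral_mono)
    fix v
    show "ennreal (exp v) * last_prob \<eta> m v * ennreal ((1 - e) / \<eta>) \<le> ennreal (exp v) * last_prob \<eta> m v * ?r v"
      using r(1)[of v] by (cases "v < 0") (auto simp: last_prob_nonneg_eq_0 intro!: mult_left_mono)
  qed
  show "ennreal (exp a) * parisian_prob \<eta> m a \<le> ennreal ((1 + e) / \<eta>) * last_mass \<eta> m"
    unfolding eq lm
  proof (rule nn_integral_mono)
    fix v
    show "ennreal (exp v) * last_prob \<eta> m v * ?r v \<le> ennreal (exp v) * last_prob \<eta> m v * ennreal ((1 + e) / \<eta>)"
      using r(2)[of v] by (cases "v < 0") (auto simp: last_prob_nonneg_eq_0 intro!: mult_left_mono)
  qed
qed

lemma parisian_prob_limit: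
  assumes \<eta>: "0 < \<eta>"
  shows "((\<lambda>a. exp a * enn2real (parisian_prob \<eta> m a)) \<longlongrightarrow> enn2real (last_mass \<eta> m) / \<eta>) at_top"
proof -
  interpret S: prob_space "drift_seq \<eta>" using \<eta> by (rule prob_space_drift_seq)
  define L where "L = enn2real (last_mass \<eta> m)"
  have L: "last_mass \<eta> m = ennreal L" "0 \<le> L"
    using last_mass_le_1[OF \<eta>, of m] by (auto simp: L_def ennreal_enn2real_if top_unique)
  define p where "p a = enn2real (parisian_prob \<eta> m a)" for a
  have p: "parisian_prob \<eta> m a = ennreal (p a)" "0 \<le> p a" for a
    by (auto simp: p_def parisian_prob_def S.emeasure_eq_measure)
  let ?e = "\<lambda>a. 2 * \<eta> / sqrt (4 * pi * (a - 1))"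
  have e: "(?e \<longlongrightarrow> 0) at_top"
    by real_asymp
  have "((\<lambda>a. exp a * p a) \<longlongrightarrow> L / \<eta>) at_top"
  proof (rule tendsto_sandwich)
    show "((\<lambda>a. (1 - ?e a) / \<eta> * L) \<longlongrightarrow> L / \<eta>) at_top"
      by (rule tendsto_eq_intros e refl | use \<eta> in simp)+
    show "((\<lambda>a. (1 + ?e a) / \<eta> * L) \<longlongrightarrow> L / \<eta>) at_top"
      by (rule tendsto_eq_intros e refl | use \<eta> in simp)+
    have *: "(1 - ?e a) / \<eta> * L \<le> exp a * p a \<and> exp a * p a \<le> (1 + ?e a) / \<eta> * L" if a: "2 \<le> a" for a
    proof
      have e0: "0 \<le> ?e a" using \<eta> a by simp
      \<comment> \<open>If the error exceeds 1 the factor is negative, and \<open>ennreal\<close>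
        would truncate it to 0; that case follows from signs alone.\<close>
      show "(1 - ?e a) / \<eta> * L \<le> exp a * p a"
      proof (cases "?e a \<le> 1")
        case True
        then show ?thesis
          using parisian_prob_bounds(1)[OF \<eta> a, of m] \<eta> L p[of a] by (simp flip: ennreal_mult)
      next
        case False
        then have "(1 - ?e a) / \<eta> * L \<le> 0" using \<eta> L(2) by (intro mult_nonpos_nonneg divide_nonpos_pos) auto
        also have "0 \<le> exp a * p a" using p by simp
        finally show ?thesis .
      qed
      show "exp a * p a \<le> (1 + ?e a) / \<eta> * L"
        using parisian_prob_bounds(2)[OF \<eta> a, of m] \<eta> L p[of a] e0 by (simp flip: ennreal_mult)
    qed
    show "\<forall>\<^sub>F a in at_top. (1 - ?e a) / \<eta> * L \<le> exp a * p a"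
      and "\<forall>\<^sub>F a in at_top. exp a * p a \<le> (1 + ?e a) / \<eta> * L"
      by (rule eventually_mono[OF eventually_ge_at_top[of 2]], use * in blast)+
  qed
  then show ?thesis unfolding p_def L_def .
qed

section \<open>The two-sided walk\<close>

text \<open>Coordinate \<open>j\<close> is the step of sqrt 2 B(t) - |t| from grid index
  \<open>j\<close> to \<open>j + 1\<close>. Left of 0 the term -|t| increases, hence the positive
  mean there.\<close>

definition zlaw :: "real \<Rightarrow> (int \<Rightarrow> real) measure" where
  "zlaw \<eta> = PiM UNIV (\<lambda>j. gauss (if j < 0 then \<eta> else - \<eta>) (2 * \<eta>))"

definition zwalk :: "(int \<Rightarrow> real) \<Rightarrow> int \<Rightarrow> real" where
  "zwalk \<omega> i = (\<Sum>j\<in>{0..<i}. \<omega> j) - (\<Sum>j\<in>{i..<0}. \<omega> j)"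

lemma zwalk_0 [simp]: "zwalk \<omega> 0 = 0"
  by (simp add: zwalk_def)

lemma zwalk_add1: "zwalk \<omega> (i + 1) = zwalk \<omega> i + \<omega> i"
proof (cases "0 \<le> i")
  case True
  then have "{0..<i + 1} = insert i {0..<i}" by auto
  with True show ?thesis by (simp add: zwalk_def)
next
  case False
  then have "{i..<0} = insert i {i + 1..<0}" by auto
  with False show ?thesis by (simp add: zwalk_def)
qed

lemma zwalk_unique:
  assumes "w 0 = 0" and "\<And>i. w (i + 1) = w i + \<omega> i"
  shows "w i = zwalk \<omega> i"
proof (induction i rule: int_induct[where k = 0])
  case (step2 i)
  then show ?case using assms(2)[of "i - 1"] zwalk_add1[of \<omega> "i - 1"] by simp
qed (use assms in \<open>simp_all add: zwalk_add1\<close>)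

lemma zwalk_shift: "zwalk (\<lambda>j. \<omega> (j + k)) i = zwalk \<omega> (i + k) - zwalk \<omega> k"
proof (rule zwalk_unique[symmetric])
  fix i
  have "i + 1 + k = i + k + 1" by simp
  then show "zwalk \<omega> (i + 1 + k) - zwalk \<omega> k = zwalk \<omega> (i + k) - zwalk \<omega> k + \<omega> (i + k)"
    by (simp only: zwalk_add1)
qed simp

lemma zwalk_of_nat: "zwalk \<omega> (int n) = walk (\<lambda>n. \<omega> (int n)) n"
  by (induction n) (simp_all add: walk_def zwalk_add1 add.commute[of 1])

lemma sets_zlaw [measurable_cong, simp]: "sets (zlaw \<eta>) = sets (PiM UNIV (\<lambda>_. borel))"
  by (auto simp: zlaw_def intro!: sets_PiM_cong)

lemma space_zlaw [simp]: "space (zlaw \<eta>) = UNIV"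
  by (simp add: zlaw_def space_PiM)

lemma prob_space_zlaw: "0 < \<eta> \<Longrightarrow> prob_space (zlaw \<eta>)"
  unfolding zlaw_def by (intro prob_space_PiM prob_space_gauss) simp

lemma measurable_zwalk [measurable]: "(\<lambda>\<omega>. zwalk \<omega> i) \<in> borel_measurable (PiM UNIV (\<lambda>_. borel))"
  unfolding zwalk_def by measurable

lemma product_prob_space_zlaw:
  "0 < \<eta> \<Longrightarrow> product_prob_space (\<lambda>j::int. gauss (if j < 0 then \<eta> else - \<eta>) (2 * \<eta>))"
  by (intro product_prob_spaceI prob_space_gauss) simp

lemma expectation_exp_half_zwalk:
  assumes \<eta>: "0 < \<eta>"
  shows "(\<integral>\<^sup>+\<omega>. ennreal (exp (zwalk \<omega> i / 2)) \<partial>zlaw \<eta>) = ennreal (exp (- (\<eta> / 4)) ^ nat \<bar>i\<bar>)"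
proof -
  let ?L = "\<lambda>j::int. gauss (if j < 0 then \<eta> else - \<eta>) (2 * \<eta>)"
  interpret product_prob_space ?L UNIV using \<eta> by (rule product_prob_space_zlaw)
  let ?J = "{0..<i} \<union> {i..<0}"
  \<comment> \<open>Steps left of 0 enter with a minus sign but also have the opposite drift, so all
    factors have the same moment.\<close>
  define s where "s j = (if j < 0 then - 1 / 2 else 1 / 2 :: real)" for j :: int
  have "zwalk \<omega> i / 2 = (\<Sum>j\<in>?J. s j * \<omega> j)" for \<omega>
  proof -
    have "(\<Sum>j\<in>?J. s j * \<omega> j) = (\<Sum>j\<in>{0..<i}. s j * \<omega> j) + (\<Sum>j\<in>{i..<0}. s j * \<omega> j)"
      by (intro sum.union_disjoint) auto
    also have "(\<Sum>j\<in>{0..<i}. s j * \<omega> j) = (\<Sum>j\<in>{0..<i}. \<omega> j) / 2"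
      unfolding sum_divide_distrib by (intro sum.cong) (auto simp: s_def)
    also have "(\<Sum>j\<in>{i..<0}. s j * \<omega> j) = - (\<Sum>j\<in>{i..<0}. \<omega> j) / 2"
      unfolding sum_divide_distrib sum_negf[symmetric] by (intro sum.cong) (auto simp: s_def)
    finally show ?thesis by (simp add: zwalk_def diff_divide_distrib)
  qed
  then have "(\<integral>\<^sup>+\<omega>. ennreal (exp (zwalk \<omega> i / 2)) \<partial>zlaw \<eta>)
      = (\<integral>\<^sup>+\<omega>. (\<Prod>j\<in>?J. ennreal (exp (s j * \<omega> j))) \<partial>zlaw \<eta>)"
    by (simp add: exp_sum prod_ennreal)
  also have "\<dots> = (\<Prod>j\<in>?J. \<integral>\<^sup>+x. ennreal (exp (s j * x)) \<partial>?L j)"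
    unfolding zlaw_def by (rule nn_integral_PiM_prod) auto
  also have "\<dots> = (\<Prod>j\<in>?J. ennreal (exp (- (\<eta> / 4))))"
    using \<eta> by (intro prod.cong refl, subst nn_integral_gauss_exp) (auto simp: s_def power2_eq_square)
  also have "\<dots> = ennreal (exp (- (\<eta> / 4)) ^ nat \<bar>i\<bar>)"
    by (cases "0 \<le> i") (simp_all add: ennreal_power)
  finally show ?thesis .
qed

lemma AE_zwalk:
  assumes \<eta>: "0 < \<eta>"
  shows "AE \<omega> in zlaw \<eta>. (\<integral>\<^sup>+i. ennreal (exp (zwalk \<omega> i / 2)) \<partial>count_space UNIV) \<noteq> \<infinity>"
proof (rule AE_summable_exp)
  let ?q = "exp (- (\<eta> / 4))"
  have fin: "(\<Sum>n. ennreal (?q ^ n)) < \<infinity>"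
    using \<eta> by (subst suminf_ennreal2) (auto intro!: summable_geometric)
  \<comment> \<open>The two half-lines share the index 0, so this is only an inequality, which is
    enough for finiteness.\<close>
  have "(\<integral>\<^sup>+i. ennreal (?q ^ nat \<bar>i\<bar>) \<partial>count_space UNIV)
      \<le> (\<integral>\<^sup>+i. ennreal (?q ^ nat \<bar>i\<bar>) * indicator (range int) i
          + ennreal (?q ^ nat \<bar>i\<bar>) * indicator (range (\<lambda>n. - int n)) i \<partial>count_space UNIV)"
  proof (rule nn_integral_mono)
    fix i :: int
    have "i \<in> range int \<or> i \<in> range (\<lambda>n. - int n)"
      by (cases i rule: int_cases2) auto
    then show "ennreal (?q ^ nat \<bar>i\<bar>) \<le> ennreal (?q ^ nat \<bar>i\<bar>) * indicator (range int) i
          + ennreal (?q ^ nat \<bar>i\<bar>) * indicator (range (\<lambda>n. - int n)) i"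
      by (auto simp: indicator_def)
  qed
  also have "\<dots> = (\<integral>\<^sup>+i. ennreal (?q ^ nat \<bar>i\<bar>) \<partial>count_space (range int))
      + (\<integral>\<^sup>+i. ennreal (?q ^ nat \<bar>i\<bar>) \<partial>count_space (range (\<lambda>n. - int n)))"
    by (simp add: nn_integral_add nn_integral_count_space_indicator)
  also have "(\<integral>\<^sup>+i. ennreal (?q ^ nat \<bar>i\<bar>) \<partial>count_space (range int)) = (\<Sum>n. ennreal (?q ^ n))"
    by (subst nn_integral_bij_count_space[symmetric, of int UNIV]) (auto simp: bij_betw_def nn_integral_count_space_nat)
  also have "(\<integral>\<^sup>+i. ennreal (?q ^ nat \<bar>i\<bar>) \<partial>count_space (range (\<lambda>n. - int n))) = (\<Sum>n. ennreal (?q ^ n))"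
    by (subst nn_integral_bij_count_space[symmetric, of "\<lambda>n. - int n" UNIV])
       (auto simp: bij_betw_def nn_integral_count_space_nat inj_on_def)
  finally have "(\<integral>\<^sup>+i. ennreal (?q ^ nat \<bar>i\<bar>) \<partial>count_space UNIV) < \<infinity>"
    using fin by (auto simp: top_unique less_top[symmetric])
  then show "(\<integral>\<^sup>+i. (\<integral>\<^sup>+\<omega>. ennreal (exp (zwalk \<omega> i / 2)) \<partial>zlaw \<eta>) \<partial>count_space UNIV) < \<infinity>"
    using \<eta> by (simp add: expectation_exp_half_zwalk)
qed measurable

text \<open>The sum in the denominator of the constant, without the factor \<eta>.\<close>

definition zmass :: "(int \<Rightarrow> real) \<Rightarrow> ennreal" where
  "zmass \<omega> = (\<integral>\<^sup>+i. ennreal (exp (zwalk \<omega> i)) \<partial>count_space UNIV)"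

lemma measurable_zmass [measurable]: "zmass \<in> borel_measurable (PiM UNIV (\<lambda>_. borel))"
  unfolding zmass_def by (rule borel_measurable_nn_integral_countable) measurable

lemma zmass_nonzero: "zmass \<omega> \<noteq> 0"
  by (simp add: zmass_def nn_integral_0_iff_AE AE_count_space)

text \<open>Each summand is the square of a summand of the half-exponent series, and so at most that
  summand times the whole series.\<close>

lemma zmass_finite:
  assumes "(\<integral>\<^sup>+i. ennreal (exp (zwalk \<omega> i / 2)) \<partial>count_space UNIV) \<noteq> \<infinity>"
  shows "zmass \<omega> \<noteq> \<infinity>"
proof -
  let ?s = "\<integral>\<^sup>+i. ennreal (exp (zwalk \<omega> i / 2)) \<partial>count_space UNIV"
  have le: "ennreal (exp (zwalk \<omega> i / 2)) \<le> ?s" for i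
    by (rule nn_integral_ge_point) simp
  have "zmass \<omega> = (\<integral>\<^sup>+i. ennreal (exp (zwalk \<omega> i / 2)) * ennreal (exp (zwalk \<omega> i / 2)) \<partial>count_space UNIV)"
    unfolding zmass_def by (intro nn_integral_cong) (simp add: mult_exp_exp flip: ennreal_mult)
  also have "\<dots> \<le> (\<integral>\<^sup>+i. ?s * ennreal (exp (zwalk \<omega> i / 2)) \<partial>count_space UNIV)"
    by (intro nn_integral_mono mult_right_mono le) simp
  also have "\<dots> = ?s * ?s" by (rule nn_integral_cmult) simp
  also have "\<dots> < \<infinity>" using assms by (simp add: ennreal_mult_less_top less_top)
  finally show ?thesis by simp
qed

lemma zmass_shift: "zmass (\<lambda>j. \<omega> (j + k)) = ennreal (exp (- zwalk \<omega> k)) * zmass \<omega>"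
proof -
  have "zmass (\<lambda>j. \<omega> (j + k))
      = (\<integral>\<^sup>+i. ennreal (exp (- zwalk \<omega> k)) * ennreal (exp (zwalk \<omega> (i + k))) \<partial>count_space UNIV)"
    unfolding zmass_def zwalk_shift
    by (intro nn_integral_cong) (simp add: mult_exp_exp flip: ennreal_mult)
  also have "\<dots> = ennreal (exp (- zwalk \<omega> k)) * (\<integral>\<^sup>+i. ennreal (exp (zwalk \<omega> (i + k))) \<partial>count_space UNIV)"
    by (rule nn_integral_cmult) simp
  also have "(\<integral>\<^sup>+i. ennreal (exp (zwalk \<omega> (i + k))) \<partial>count_space UNIV) = zmass \<omega>"
    unfolding zmass_def by (rule nn_integral_bij_count_space) (auto intro!: bij_betwI[of _ _ _ "\<lambda>i. i - k"])
  finally show ?thesis .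
qed

section \<open>Moving the time origin of the two-sided walk\<close>

lemma measurable_shift:
  "(\<lambda>\<omega> j. \<omega> (j + k)) \<in> measurable (PiM UNIV (\<lambda>_::int. borel :: real measure)) (PiM UNIV (\<lambda>_. borel))"
  by (rule measurable_PiM_single') (auto simp: space_PiM)

text \<open>Shifting the time origin by one changes only the drift of the step \<open>-1\<close>, hence amounts to an
  exponential tilt.\<close>

lemma nn_integral_zlaw_shift1:
  assumes \<eta>: "0 < \<eta>" and F [measurable]: "F \<in> borel_measurable (PiM UNIV (\<lambda>_. borel))"
  shows "(\<integral>\<^sup>+\<omega>. F (\<lambda>j. \<omega> (j + 1)) \<partial>zlaw \<eta>) = (\<integral>\<^sup>+\<omega>. F \<omega> * ennreal (exp (zwalk \<omega> (- 1))) \<partial>zlaw \<eta>)"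
proof -
  let ?L = "\<lambda>j::int. gauss (if j < 0 then \<eta> else - \<eta>) (2 * \<eta>)"
  let ?f = "\<lambda>x. ennreal (exp ((- 1) * x))"
  interpret product_prob_space ?L UNIV using \<eta> by (rule product_prob_space_zlaw)
  have dens: "density (gauss \<eta> (2 * \<eta>)) ?f = gauss (- \<eta>) (2 * \<eta>)"
  proof (rule measure_eqI)
    fix A assume "A \<in> sets (density (gauss \<eta> (2 * \<eta>)) ?f)"
    then have [measurable]: "A \<in> sets borel" by simp
    have "emeasure (density (gauss \<eta> (2 * \<eta>)) ?f) A = (\<integral>\<^sup>+x. ?f x * indicator A x \<partial>gauss \<eta> (2 * \<eta>))"
      by (subst emeasure_density) auto
    also have "\<dots> = (\<integral>\<^sup>+x. indicator A x \<partial>gauss (- \<eta>) (2 * \<eta>))"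
      using \<eta> by (subst nn_integral_gauss_tilt) auto
    finally show "emeasure (density (gauss \<eta> (2 * \<eta>)) ?f) A = emeasure (gauss (- \<eta>) (2 * \<eta>)) A"
      by simp
  qed simp
  \<comment> \<open>The laws of the coordinates \<open>j\<close> and \<open>j + 1\<close> differ
    only for j = -1, where the mean passes from \<eta> to -\<eta>.\<close>
  have shifted: "PiM UNIV (\<lambda>j. ?L (j + 1)) = density (zlaw \<eta>) (\<lambda>\<omega>. ?f (\<omega> (- 1)))"
  proof -
    have L1: "?L (- 1) = gauss \<eta> (2 * \<eta>)" by simp
    have ps: "prob_space (density (?L (- 1)) ?f)"
      unfolding L1 dens using \<eta> by (intro prob_space_gauss) simp
    have "density (PiM UNIV ?L) (\<lambda>\<omega>. ?f (\<omega> (- 1))) = PiM UNIV (?L(- 1 := density (?L (- 1)) ?f))"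
      by (rule density_PiM_component[OF refl _ ps]) simp
    also have "?L(- 1 := density (?L (- 1)) ?f) = (\<lambda>j. ?L (j + 1))"
      unfolding L1 dens by (auto simp: fun_eq_iff)
    finally show ?thesis unfolding zlaw_def by simp
  qed
  have "distr (PiM UNIV ?L) (PiM UNIV (\<lambda>j. ?L (j + 1))) (\<lambda>\<omega>. \<lambda>n\<in>UNIV. \<omega> (n + 1)) = PiM UNIV (\<lambda>j. ?L (j + 1))"
    using \<eta> by (intro distr_PiM_reindex prob_space_gauss) (auto simp: inj_on_def)
  then have dist: "distr (zlaw \<eta>) (PiM UNIV (\<lambda>_. borel)) (\<lambda>\<omega> n. \<omega> (n + 1)) = density (zlaw \<eta>) (\<lambda>\<omega>. ?f (\<omega> (- 1)))"
    unfolding shifted[symmetric] zlaw_def[symmetric]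
    by (subst (asm) distr_cong[OF refl _ refl, of _ "PiM UNIV (\<lambda>_. borel)"])
       (auto intro!: sets_PiM_cong simp: restrict_def)
  have z: "zwalk \<omega> (- 1) = - \<omega> (- 1)" for \<omega>
    using zwalk_add1[of \<omega> "- 1"] by simp
  have "(\<integral>\<^sup>+\<omega>. F (\<lambda>j. \<omega> (j + 1)) \<partial>zlaw \<eta>) = (\<integral>\<^sup>+\<omega>. F \<omega> \<partial>distr (zlaw \<eta>) (PiM UNIV (\<lambda>_. borel)) (\<lambda>\<omega> n. \<omega> (n + 1)))"
    using measurable_shift[of 1] by (subst nn_integral_distr) (simp_all add: measurable_cong_sets[OF sets_zlaw refl])
  also have "\<dots> = (\<integral>\<^sup>+\<omega>. ?f (\<omega> (- 1)) * F \<omega> \<partial>zlaw \<eta>)"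
    unfolding dist by (subst nn_integral_density) auto
  finally show ?thesis by (simp add: z mult.commute)
qed

lemma nn_integral_zlaw_shift:
  assumes \<eta>: "0 < \<eta>" and "F \<in> borel_measurable (PiM UNIV (\<lambda>_. borel))"
  shows "(\<integral>\<^sup>+\<omega>. F (\<lambda>j. \<omega> (j + k)) \<partial>zlaw \<eta>) = (\<integral>\<^sup>+\<omega>. F \<omega> * ennreal (exp (zwalk \<omega> (- k))) \<partial>zlaw \<eta>)"
  using assms(2)
proof (induction k arbitrary: F rule: int_induct[where k = 0])
  case base
  then show ?case by simp
next
  case (step1 k)
  note [measurable] = step1.prems
  \<comment> \<open>Evaluated at the path shifted by \<open>k\<close>, the exponent of
    \<open>?G\<close> becomes \<open>zwalk \<omega> (- 1)\<close>, the tilt of the additional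
    step.\<close>
  let ?G = "\<lambda>\<omega>. F \<omega> * ennreal (exp (zwalk \<omega> (- 1 - k) - zwalk \<omega> (- k)))"
  have "(\<integral>\<^sup>+\<omega>. F (\<lambda>j. \<omega> (j + (k + 1))) \<partial>zlaw \<eta>) = (\<integral>\<^sup>+\<omega>. F (\<lambda>j. \<omega> (j + k)) * ennreal (exp (zwalk \<omega> (- 1))) \<partial>zlaw \<eta>)"
    using nn_integral_zlaw_shift1[OF \<eta>, of "\<lambda>\<omega>. F (\<lambda>j. \<omega> (j + k))"]
    by (simp add: add.assoc add.commute[of 1] measurable_compose[OF measurable_shift step1.prems])
  also have "\<dots> = (\<integral>\<^sup>+\<omega>. ?G (\<lambda>j. \<omega> (j + k)) \<partial>zlaw \<eta>)"
    by (simp add: zwalk_shift)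
  also have "\<dots> = (\<integral>\<^sup>+\<omega>. ?G \<omega> * ennreal (exp (zwalk \<omega> (- k))) \<partial>zlaw \<eta>)"
    by (rule step1.IH) measurable
  finally show ?case
    by (simp add: mult.assoc mult_exp_exp algebra_simps flip: ennreal_mult)
next
  case (step2 k)
  note [measurable] = step2.prems
  have [measurable]: "(\<lambda>\<omega>. F (\<lambda>j. \<omega> (j + (k - 1)))) \<in> borel_measurable (PiM UNIV (\<lambda>_. borel))"
    by (rule measurable_compose[OF measurable_shift step2.prems])
  let ?G = "\<lambda>\<omega>. F \<omega> * ennreal (exp (zwalk \<omega> (1 - k) - zwalk \<omega> (- k)))"
  \<comment> \<open>To go backwards, \<open>?H\<close> carries the inverse of the one-step tilt,
    which the next two lines cancel and trade for a shift.\<close>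
  let ?H = "\<lambda>\<omega>. F (\<lambda>j. \<omega> (j + (k - 1))) * ennreal (exp (- zwalk \<omega> (- 1)))"
  have "(\<integral>\<^sup>+\<omega>. F (\<lambda>j. \<omega> (j + (k - 1))) \<partial>zlaw \<eta>) = (\<integral>\<^sup>+\<omega>. ?H \<omega> * ennreal (exp (zwalk \<omega> (- 1))) \<partial>zlaw \<eta>)"
    by (simp add: mult.assoc mult_exp_exp flip: ennreal_mult)
  also have "\<dots> = (\<integral>\<^sup>+\<omega>. ?H (\<lambda>j. \<omega> (j + 1)) \<partial>zlaw \<eta>)"
    by (rule nn_integral_zlaw_shift1[OF \<eta>, symmetric]) measurable
  also have "\<dots> = (\<integral>\<^sup>+\<omega>. ?G (\<lambda>j. \<omega> (j + k)) \<partial>zlaw \<eta>)"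
    by (simp add: zwalk_shift)
  also have "\<dots> = (\<integral>\<^sup>+\<omega>. ?G \<omega> * ennreal (exp (zwalk \<omega> (- k))) \<partial>zlaw \<eta>)"
    by (rule step2.IH) measurable
  finally show ?case
    by (simp add: mult.assoc mult_exp_exp algebra_simps flip: ennreal_mult)
qed

section \<open>The supremum as a sum over last windows, and the mass transport\<close>

definition zlast :: "nat \<Rightarrow> (int \<Rightarrow> real) \<Rightarrow> int \<Rightarrow> ennreal" where
  "zlast m \<omega> i = (\<integral>\<^sup>+v. ennreal (exp v) * of_bool (last_above m (zwalk \<omega>) v i) \<partial>lborel)"

lemma pred_above_zwalk [measurable]:
  assumes [measurable]: "f \<in> measurable M (PiM UNIV (\<lambda>_. borel))" "g \<in> borel_measurable M"
  shows "Measurable.pred M (\<lambda>x. above m (zwalk (f x)) (g x) k)"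
  unfolding above_def by measurable

lemma pred_last_above_zwalk [measurable]:
  assumes [measurable]: "f \<in> measurable M (PiM UNIV (\<lambda>_. borel))" "g \<in> borel_measurable M"
  shows "Measurable.pred M (\<lambda>x. last_above m (zwalk (f x)) (g x) k)"
  unfolding last_above_def by measurable

lemma pred_last_above_zwalk_level [measurable]:
  "Measurable.pred borel (\<lambda>v. last_above m (zwalk \<omega>) v i)"
  by (rule pred_last_above_zwalk) (simp_all add: space_PiM)

lemma measurable_zlast [measurable]: "(\<lambda>\<omega>. zlast m \<omega> i) \<in> borel_measurable (PiM UNIV (\<lambda>_. borel))"
  unfolding zlast_def by measurable

text \<open>Levels are lowered by \<open>zwalk \<omega> k\<close>, which rescales e^v dv by the same
  factor as \<open>zmass_shift\<close>. In the quotient by \<open>zmass\<close> the factor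
  cancels.\<close>

lemma zlast_shift: "zlast m (\<lambda>j. \<omega> (j + k)) 0 = ennreal (exp (- zwalk \<omega> k)) * zlast m \<omega> k"
proof -
  have ab: "above m (zwalk (\<lambda>j. \<omega> (j + k))) v i \<longleftrightarrow> above m (zwalk \<omega>) (zwalk \<omega> k + v) (i + k)" for v i
    by (simp add: above_def zwalk_shift ac_simps less_diff_eq)
  have all: "(\<forall>j>0. P (j + k)) \<longleftrightarrow> (\<forall>j>k. P j)" for P :: "int \<Rightarrow> bool"
    by (metis add.commute add_0 diff_add_cancel diff_gt_0_iff_gt less_add_same_cancel1)
  have la: "last_above m (zwalk (\<lambda>j. \<omega> (j + k))) v 0 \<longleftrightarrow> last_above m (zwalk \<omega>) (zwalk \<omega> k + v) k" for v
    unfolding last_above_def ab using all[of "\<lambda>j. \<not> above m (zwalk \<omega>) (zwalk \<omega> k + v) j"] by simp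
  have "zlast m \<omega> k = (\<integral>\<^sup>+v. ennreal (exp (zwalk \<omega> k + v)) * of_bool (last_above m (zwalk \<omega>) (zwalk \<omega> k + v) k) \<partial>lborel)"
    unfolding zlast_def by (subst nn_integral_real_affine[where c = 1 and t = "zwalk \<omega> k"]) auto
  also have "\<dots> = (\<integral>\<^sup>+v. ennreal (exp (zwalk \<omega> k)) * (ennreal (exp v) * of_bool (last_above m (zwalk (\<lambda>j. \<omega> (j + k))) v 0)) \<partial>lborel)"
    unfolding la by (simp add: exp_add ennreal_mult mult.assoc)
  also have "\<dots> = ennreal (exp (zwalk \<omega> k)) * zlast m (\<lambda>j. \<omega> (j + k)) 0"
    unfolding zlast_def by (rule nn_integral_cmult) measurable
  finally show ?thesis
    by (simp add: mult.assoc[symmetric] mult_exp_exp flip: ennreal_mult)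
qed

definition zsup :: "nat \<Rightarrow> (int \<Rightarrow> real) \<Rightarrow> ennreal" where
  "zsup m \<omega> = (SUP i. INF j\<in>{i..i + int m}. ennreal (exp (zwalk \<omega> j)))"

text \<open>A level has a window above it exactly if it lies below the largest window minimum, and
  it then has exactly one last window. Hence the shares of the starting points add up to the
  exponential of that largest minimum.\<close>

lemma zsup_eq_sum_zlast:
  assumes fin: "\<And>v. finite {i. v < zwalk \<omega> i}"
  shows "zsup m \<omega> = (\<integral>\<^sup>+i. zlast m \<omega> i \<partial>count_space UNIV)"
proof -
  define y where "y i = Min (zwalk \<omega> ` {i..i + int m})" for i
  have y_in: "y i \<in> zwalk \<omega> ` {i..i + int m}" for i
    unfolding y_def by (intro Min_in) auto
  have y_le: "y i \<le> zwalk \<omega> j" if "j \<in> {i..i + int m}" for i j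
    unfolding y_def using that by (intro Min_le) auto
  have above_y: "above m (zwalk \<omega>) v i \<longleftrightarrow> v < y i" for v i
  proof -
    have "(\<forall>j\<in>{i..i + int m}. P j) \<longleftrightarrow> (\<forall>j\<le>m. P (i + int j))" for P
    proof safe
      fix j assume "\<forall>j\<le>m. P (i + int j)" "j \<in> {i..i + int m}"
      then show "P j" using spec[of "\<lambda>j. j \<le> m \<longrightarrow> P (i + int j)" "nat (j - i)"] by auto
    qed auto
    then show ?thesis unfolding above_def y_def by (subst Min_gr_iff) auto
  qed
  have inf_y: "(INF j\<in>{i..i + int m}. ennreal (exp (zwalk \<omega> j))) = ennreal (exp (y i))" for i
  proof (rule antisym)
    obtain j where j: "y i = zwalk \<omega> j" "j \<in> {i..i + int m}" using y_in[of i] by blast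
    show "(INF j\<in>{i..i + int m}. ennreal (exp (zwalk \<omega> j))) \<le> ennreal (exp (y i))"
      unfolding j(1) by (rule INF_lower) (rule j(2))
  qed (use y_le in \<open>auto intro!: INF_greatest ennreal_leI\<close>)
  \<comment> \<open>A window minimum is at most the first value of the window, so only finitely many
    windows reach \<open>y 0\<close> and the largest minimum is attained.\<close>
  obtain i0 where i0: "\<And>i. y i \<le> y i0"
  proof -
    let ?A = "{i. y 0 \<le> y i}"
    have "finite ?A"
    proof (rule finite_subset)
      show "?A \<subseteq> {i. y 0 - 1 < zwalk \<omega> i}"
      proof clarify
        fix i assume "y 0 \<le> y i"
        moreover have "y i \<le> zwalk \<omega> i" by (rule y_le) simp
        ultimately show "y 0 - 1 < zwalk \<omega> i" by linarith
      qed
    qed (rule fin)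
    moreover have "0 \<in> ?A" by simp
    ultimately have A: "finite (y ` ?A)" "y ` ?A \<noteq> {}" by blast+
    obtain i0 where i0: "i0 \<in> ?A" "y i0 = Max (y ` ?A)" using Max_in[OF A] by auto
    then have "y i \<le> y i0" if "i \<in> ?A" for i using A that by simp
    moreover have "y i \<le> y i0" if "i \<notin> ?A" for i using i0(1) that by simp
    ultimately have "y i \<le> y i0" for i by blast
    then show thesis by (rule that)
  qed
  have ex: "(\<exists>i. above m (zwalk \<omega>) v i) \<longleftrightarrow> v < y i0" for v
    unfolding above_y using i0 by (meson less_le_trans)
  have "(\<integral>\<^sup>+i. zlast m \<omega> i \<partial>count_space UNIV)
      = (\<integral>\<^sup>+v. (\<integral>\<^sup>+i. ennreal (exp v) * of_bool (last_above m (zwalk \<omega>) v i) \<partial>count_space UNIV) \<partial>lborel)"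
    unfolding zlast_def by (subst nn_integral_count_space_nn_integral) auto
  also have "\<dots> = (\<integral>\<^sup>+v. ennreal (exp v) * of_bool (v < y i0) \<partial>lborel)"
    by (intro nn_integral_cong) (simp add: nn_integral_cmult nn_integral_last_above[OF fin] ex)
  also have "\<dots> = ennreal (exp (y i0))" by (rule nn_integral_exp_less)
  also have "\<dots> = zsup m \<omega>"
    unfolding zsup_def inf_y by (intro antisym SUP_least SUP_upper) (auto intro!: ennreal_leI i0)
  finally show ?thesis ..
qed

text \<open>Whether the last window starts at 0 depends only on the steps with nonnegative index,
  and these have the one-sided law; Tonelli then integrates over levels last.\<close>

lemma expectation_zlast_0:
  assumes \<eta>: "0 < \<eta>"
  shows "(\<integral>\<^sup>+\<omega>. zlast m \<omega> 0 \<partial>zlaw \<eta>) = last_mass \<eta> m"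
proof -
  interpret S: prob_space "drift_seq \<eta>" using \<eta> by (rule prob_space_drift_seq)
  interpret P: pair_sigma_finite lborel "drift_seq \<eta>" ..
  let ?L = "\<lambda>j::int. gauss (if j < 0 then \<eta> else - \<eta>) (2 * \<eta>)"
  have "distr (PiM UNIV ?L) (PiM UNIV (\<lambda>n. ?L (int n))) (\<lambda>\<omega>. \<lambda>n\<in>UNIV. \<omega> (int n)) = PiM UNIV (\<lambda>n. ?L (int n))"
    using \<eta> by (intro distr_PiM_reindex prob_space_gauss) (auto simp: inj_on_def)
  then have dist: "distr (zlaw \<eta>) (drift_seq \<eta>) (\<lambda>\<omega> n. \<omega> (int n)) = drift_seq \<eta>"
    by (simp add: zlaw_def drift_seq_def restrict_def)
  have meas: "(\<lambda>\<omega> n. \<omega> (int n)) \<in> measurable (zlaw \<eta>) (drift_seq \<eta>)"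
    unfolding measurable_cong_sets[OF sets_zlaw sets_drift_seq]
    by (rule measurable_PiM_single') (auto simp: space_PiM)
  let ?D = "\<lambda>\<omega>. \<integral>\<^sup>+v. ennreal (exp v) * of_bool (last_above m (walk \<omega>) v 0) \<partial>lborel"
  have above: "above m (zwalk \<omega>) v (int k) \<longleftrightarrow> above m (walk (\<lambda>n. \<omega> (int n))) v k" for \<omega> v k
    by (simp add: above_def zwalk_of_nat[symmetric])
  have all: "(\<forall>j>0. P j) \<longleftrightarrow> (\<forall>k>0. P (int k))" for P
    by (metis of_nat_0_less_iff zero_less_imp_eq_int)
  have last: "last_above m (zwalk \<omega>) v 0 \<longleftrightarrow> last_above m (walk (\<lambda>n. \<omega> (int n))) v 0" for \<omega> v
    unfolding last_above_def all[of "\<lambda>j. \<not> above m (zwalk \<omega>) v j"] using above[of \<omega> v 0] by (simp add: above)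
  have D [measurable]: "?D \<in> borel_measurable (drift_seq \<eta>)" by measurable
  have "(\<integral>\<^sup>+\<omega>. zlast m \<omega> 0 \<partial>zlaw \<eta>) = (\<integral>\<^sup>+\<omega>. ?D (\<lambda>n. \<omega> (int n)) \<partial>zlaw \<eta>)"
    by (simp add: zlast_def last)
  also have "\<dots> = (\<integral>\<^sup>+\<omega>. ?D \<omega> \<partial>distr (zlaw \<eta>) (drift_seq \<eta>) (\<lambda>\<omega> n. \<omega> (int n)))"
    using D by (intro nn_integral_distr[symmetric] meas) simp
  also have "\<dots> = (\<integral>\<^sup>+v. (\<integral>\<^sup>+\<omega>. ennreal (exp v) * of_bool (last_above m (walk \<omega>) v 0) \<partial>drift_seq \<eta>) \<partial>lborel)"
    unfolding dist by (rule P.Fubini') measurable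
  also have "\<dots> = last_mass \<eta> m"
    unfolding last_mass_def
  proof (rule nn_integral_cong)
    fix v
    have "{\<omega>. last_above m (walk \<omega>) v 0} \<in> sets (drift_seq \<eta>)"
      unfolding sets_drift_seq by (rule sets_PiM_Collect) measurable
    then show "(\<integral>\<^sup>+\<omega>. ennreal (exp v) * of_bool (last_above m (walk \<omega>) v 0) \<partial>drift_seq \<eta>) = ennreal (exp v) * last_prob \<eta> m v"
      unfolding last_prob_def by (simp add: nn_integral_cmult emeasure_Collect)
  qed
  finally show ?thesis .
qed

text \<open>The mass transport: \<open>zlast m \<omega> i / zmass \<omega>\<close> is the value at the path shifted by \<open>i\<close> of
  \<open>zlast m \<omega> 0 / zmass \<omega>\<close>, and the tilts sum up to \<open>zmass \<omega>\<close>.\<close>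

lemma expectation_zsup:
  assumes \<eta>: "0 < \<eta>"
  shows "(\<integral>\<^sup>+\<omega>. zsup m \<omega> / (ennreal \<eta> * zmass \<omega>) \<partial>zlaw \<eta>) = last_mass \<eta> m / ennreal \<eta>"
proof -
  let ?F = "\<lambda>\<omega>. zlast m \<omega> 0 / zmass \<omega>"
  \<comment> \<open>Finiteness of the exceedances makes last windows exist; finiteness of
    \<open>zmass\<close> permits cancelling it in \<open>ennreal\<close>.\<close>
  have AEf: "AE \<omega> in zlaw \<eta>. (\<forall>v. finite {i. v < zwalk \<omega> i}) \<and> zmass \<omega> \<noteq> \<infinity>"
    using AE_zwalk[OF \<eta>]
    by eventually_elim (metis finite_exceed_of_summable_exp zmass_finite)
  have F_shift: "?F (\<lambda>j. \<omega> (j + k)) = zlast m \<omega> k / zmass \<omega>" for \<omega> k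
    unfolding zlast_shift zmass_shift
    by (simp add: mult.commute[of "ennreal (exp (- zwalk \<omega> k))"] divide_mult_eq)
  have "(\<integral>\<^sup>+\<omega>. zsup m \<omega> / (ennreal \<eta> * zmass \<omega>) \<partial>zlaw \<eta>)
      = (\<integral>\<^sup>+\<omega>. (\<integral>\<^sup>+i. zlast m \<omega> i / zmass \<omega> \<partial>count_space UNIV) / ennreal \<eta> \<partial>zlaw \<eta>)"
    using AEf
  proof (intro nn_integral_cong_AE, eventually_elim)
    case (elim \<omega>)
    then have "zsup m \<omega> = (\<integral>\<^sup>+i. zlast m \<omega> i \<partial>count_space UNIV)" by (intro zsup_eq_sum_zlast) auto
    moreover have "inverse (ennreal \<eta> * zmass \<omega>) = inverse (zmass \<omega>) * inverse (ennreal \<eta>)"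
      using elim \<eta> zmass_nonzero[of \<omega>] by (subst ennreal_inverse_mult) (auto simp: mult.commute less_top)
    ultimately show ?case
      by (simp add: divide_ennreal_def nn_integral_multc mult.assoc)
  qed
  also have "\<dots> = (\<integral>\<^sup>+\<omega>. (\<integral>\<^sup>+i. zlast m \<omega> i / zmass \<omega> \<partial>count_space UNIV) \<partial>zlaw \<eta>) / ennreal \<eta>"
    by (intro nn_integral_divide borel_measurable_nn_integral_countable) measurable
  also have "(\<integral>\<^sup>+\<omega>. (\<integral>\<^sup>+i. zlast m \<omega> i / zmass \<omega> \<partial>count_space UNIV) \<partial>zlaw \<eta>)
      = (\<integral>\<^sup>+i. (\<integral>\<^sup>+\<omega>. ?F (\<lambda>j. \<omega> (j + i)) \<partial>zlaw \<eta>) \<partial>count_space UNIV)"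
    unfolding F_shift by (rule nn_integral_count_space_nn_integral) auto
  also have "\<dots> = (\<integral>\<^sup>+i. (\<integral>\<^sup>+\<omega>. ?F \<omega> * ennreal (exp (zwalk \<omega> (- i))) \<partial>zlaw \<eta>) \<partial>count_space UNIV)"
    by (intro nn_integral_cong nn_integral_zlaw_shift[OF \<eta>]) measurable
  also have "\<dots> = (\<integral>\<^sup>+\<omega>. (\<integral>\<^sup>+i. ?F \<omega> * ennreal (exp (zwalk \<omega> (- i))) \<partial>count_space UNIV) \<partial>zlaw \<eta>)"
    by (rule nn_integral_count_space_nn_integral[symmetric]) auto
  also have "\<dots> = (\<integral>\<^sup>+\<omega>. zlast m \<omega> 0 \<partial>zlaw \<eta>)"
    using AEf
  proof (intro nn_integral_cong_AE, eventually_elim)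
    case (elim \<omega>)
    have "(\<integral>\<^sup>+i. ?F \<omega> * ennreal (exp (zwalk \<omega> (- i))) \<partial>count_space UNIV)
        = ?F \<omega> * (\<integral>\<^sup>+i. ennreal (exp (zwalk \<omega> (- i))) \<partial>count_space UNIV)"
      by (rule nn_integral_cmult) simp
    also have "(\<integral>\<^sup>+i. ennreal (exp (zwalk \<omega> (- i))) \<partial>count_space UNIV) = zmass \<omega>"
      unfolding zmass_def by (rule nn_integral_bij_count_space) (auto intro!: bij_betwI[of _ _ _ uminus])
    also have "?F \<omega> * zmass \<omega> = zlast m \<omega> 0 * zmass \<omega> / zmass \<omega>"
      by (simp add: ennreal_times_divide mult.commute)
    also have "\<dots> = zlast m \<omega> 0"
      using elim zmass_nonzero[of \<omega>] by (intro ennreal_mult_divide_eq) auto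
    finally show ?case .
  qed
  finally show ?thesis using \<eta> by (simp add: expectation_zlast_0)
qed

lemma zsup_nonzero: "zsup m \<omega> \<noteq> 0"
proof -
  have "0 < ennreal (exp (Min (zwalk \<omega> ` {0..0 + int m})))" by simp
  also have "\<dots> \<le> (INF j\<in>{0..0 + int m}. ennreal (exp (zwalk \<omega> j)))"
    by (intro INF_greatest ennreal_leI) auto
  also have "\<dots> \<le> zsup m \<omega>"
    unfolding zsup_def by (rule SUP_upper) simp
  finally show ?thesis by simp
qed

lemma measurable_zsup [measurable]: "zsup m \<in> borel_measurable (PiM UNIV (\<lambda>_. borel))"
  unfolding zsup_def by (intro borel_measurable_SUP borel_measurable_INF) auto

text \<open>Positivity is read off from the two-sided formula, whose integrand is almost surely
  positive.\<close>

lemma last_mass_pos: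
  assumes \<eta>: "0 < \<eta>"
  shows "last_mass \<eta> m \<noteq> 0"
proof
  interpret prob_space "zlaw \<eta>" using \<eta> by (rule prob_space_zlaw)
  assume "last_mass \<eta> m = 0"
  then have "(\<integral>\<^sup>+\<omega>. zsup m \<omega> / (ennreal \<eta> * zmass \<omega>) \<partial>zlaw \<eta>) = 0"
    by (simp add: expectation_zsup[OF \<eta>])
  then have "AE \<omega> in zlaw \<eta>. zsup m \<omega> / (ennreal \<eta> * zmass \<omega>) = 0"
    by (subst (asm) nn_integral_0_iff_AE) auto
  then have "AE \<omega> in zlaw \<eta>. False"
    using AE_zwalk[OF \<eta>]
  proof eventually_elim
    case (elim \<omega>)
    then have "zmass \<omega> \<noteq> \<infinity>" by (intro zmass_finite)
    with elim(1) show False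
      using zsup_nonzero[of m \<omega>] \<eta> by (simp add: divide_ennreal_def ennreal_mult_eq_top_iff ennreal_inverse_eq_0_iff)
  qed
  then show False by simp
qed

section \<open>Brownian motion on a grid\<close>

text \<open>The constant is defined with an unordered sum, while Tonelli is applied to integrals
  over counting measure.\<close>

lemma infsum_ennreal_eq_nn_integral:
  fixes f :: "int \<Rightarrow> ennreal"
  shows "infsum f UNIV = (\<integral>\<^sup>+i. f i \<partial>count_space UNIV)"
proof (rule antisym)
  have inf: "infsum f UNIV = (SUP F\<in>{F. finite F \<and> F \<subseteq> UNIV}. sum f F)"
    by (rule nonneg_infsum_complete) simp
  show "infsum f UNIV \<le> (\<integral>\<^sup>+i. f i \<partial>count_space UNIV)"
    unfolding inf
  proof (rule SUP_least)
    fix F :: "int set" assume "F \<in> {F. finite F \<and> F \<subseteq> UNIV}"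
    then have "sum f F = (\<integral>\<^sup>+i. f i * indicator F i \<partial>count_space UNIV)"
      by (simp add: nn_integral_count_space_finite flip: nn_integral_count_space_indicator)
    also have "\<dots> \<le> (\<integral>\<^sup>+i. f i \<partial>count_space UNIV)"
      by (intro nn_integral_mono) (auto simp: indicator_def)
    finally show "sum f F \<le> (\<integral>\<^sup>+i. f i \<partial>count_space UNIV)" .
  qed
  have "(\<integral>\<^sup>+i. f i \<partial>count_space UNIV) = (\<integral>\<^sup>+n. f (int_decode n) \<partial>count_space UNIV)"
    by (rule nn_integral_bij_count_space[symmetric]) (rule bij_int_decode)
  also have "\<dots> = (SUP n. \<Sum>k<n. f (int_decode k))"
    by (simp add: nn_integral_count_space_nat suminf_eq_SUP)
  also have "\<dots> \<le> infsum f UNIV"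
    unfolding inf
  proof (rule SUP_least)
    fix n
    have "(\<Sum>k<n. f (int_decode k)) = sum f (int_decode ` {..<n})"
      by (subst sum.reindex) (auto intro: inj_on_subset[OF inj_int_decode])
    also have "\<dots> \<le> (SUP F\<in>{F. finite F \<and> F \<subseteq> UNIV}. sum f F)"
      by (rule SUP_upper) auto
    finally show "(\<Sum>k<n. f (int_decode k)) \<le> (SUP F\<in>{F. finite F \<and> F \<subseteq> UNIV}. sum f F)" .
  qed
  finally show "(\<integral>\<^sup>+i. f i \<partial>count_space UNIV) \<le> infsum f UNIV" .
qed

section \<open>From Brownian increments to the product laws\<close>

lemma brownian_increment_law:
  assumes B: "brownian_motion_on I M B" and st: "s \<in> I" "t \<in> I" "s < t" and \<alpha>: "\<alpha> \<noteq> 0"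
  shows "distr M borel (\<lambda>\<omega>. \<beta> + \<alpha> * (B t \<omega> - B s \<omega>)) = gauss \<beta> (\<alpha>\<^sup>2 * (t - s))"
    and "(\<lambda>\<omega>. \<beta> + \<alpha> * (B t \<omega> - B s \<omega>)) \<in> borel_measurable M"
proof -
  interpret prob_space M using B by (simp add: brownian_motion_on_def)
  have "distributed M lborel (\<lambda>\<omega>. B t \<omega> - B s \<omega>) (normal_density 0 (sqrt (t - s)))"
    using B st by (simp add: brownian_motion_on_def)
  then have "distributed M lborel (\<lambda>\<omega>. \<beta> + \<alpha> * (B t \<omega> - B s \<omega>)) (normal_density (\<beta> + \<alpha> * 0) (\<bar>\<alpha>\<bar> * sqrt (t - s)))"
    by (rule normal_density_affine) (use st \<alpha> in auto)
  moreover have "\<bar>\<alpha>\<bar> * sqrt (t - s) = sqrt (\<alpha>\<^sup>2 * (t - s))"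
    by (simp add: real_sqrt_mult)
  ultimately show "distr M borel (\<lambda>\<omega>. \<beta> + \<alpha> * (B t \<omega> - B s \<omega>)) = gauss \<beta> (\<alpha>\<^sup>2 * (t - s))"
    and "(\<lambda>\<omega>. \<beta> + \<alpha> * (B t \<omega> - B s \<omega>)) \<in> borel_measurable M"
    by (auto simp: distributed_def gauss_def cong: distr_cong)
qed

lemma brownian_indep_increments:
  assumes B: "brownian_motion_on I M B" and t: "strict_mono_on {..n} t" "t ` {..n} \<subseteq> I"
  shows "prob_space.indep_vars M (\<lambda>_. borel) (\<lambda>k \<omega>. \<beta> k + \<alpha> * (B (t (Suc k)) \<omega> - B (t k) \<omega>)) {..<n}"
proof -
  interpret prob_space M using B by (simp add: brownian_motion_on_def)
  have "indep_vars (\<lambda>_. borel) (\<lambda>k \<omega>. B (t (Suc k)) \<omega> - B (t k) \<omega>) {..<n}"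
    using B t unfolding brownian_motion_on_def by blast
  then show ?thesis
    by (rule indep_vars_compose2[where Y = "\<lambda>k x. \<beta> k + \<alpha> * x"]) simp
qed

text \<open>The scale 2c is the one at which the variance 4c^2 h of a step is twice the size 2c^2 h
  of its drift.\<close>

lemma distr_drift_seq:
  assumes B: "standard_brownian_motion M B" and c: "0 < c" and h: "0 < h"
  shows "distr M (drift_seq (2 * c\<^sup>2 * h))
      (\<lambda>\<omega> n. - (2 * c\<^sup>2 * h) + 2 * c * (B (h * real (Suc n)) \<omega> - B (h * real n) \<omega>)) = drift_seq (2 * c\<^sup>2 * h)"
    and "(\<lambda>\<omega> n. - (2 * c\<^sup>2 * h) + 2 * c * (B (h * real (Suc n)) \<omega> - B (h * real n) \<omega>))
      \<in> measurable M (drift_seq (2 * c\<^sup>2 * h))"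
proof -
  interpret prob_space M using B by (simp add: brownian_motion_on_def)
  let ?\<eta> = "2 * c\<^sup>2 * h"
  let ?X = "\<lambda>n \<omega>. - ?\<eta> + 2 * c * (B (h * real (Suc n)) \<omega> - B (h * real n) \<omega>)"
  have X: "distr M borel (?X n) = gauss (- ?\<eta>) (2 * ?\<eta>)" "?X n \<in> borel_measurable M" for n
  proof -
    have lt: "h * real n < h * real (Suc n)" using h by simp
    have var: "(2 * c)\<^sup>2 * (h * real (Suc n) - h * real n) = 2 * ?\<eta>"
      by (simp add: power2_eq_square algebra_simps)
    note law = brownian_increment_law[OF B _ _ lt, where \<alpha> = "2 * c" and \<beta> = "- ?\<eta>", unfolded var]
    show "distr M borel (?X n) = gauss (- ?\<eta>) (2 * ?\<eta>)" "?X n \<in> borel_measurable M"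
      using h c by (intro law; simp)+
  qed
  show "distr M (drift_seq ?\<eta>) (\<lambda>\<omega> n. ?X n \<omega>) = drift_seq ?\<eta>"
    unfolding drift_seq_def
  proof (rule distr_eq_PiM)
    fix J :: "nat set" assume "finite J"
    then obtain n where n: "J \<subseteq> {..<n}" by (metis finite_nat_iff_bounded)
    have "indep_vars (\<lambda>_. borel) (\<lambda>k. ?X (id k)) {..<n}"
      unfolding id_apply
      by (rule brownian_indep_increments[OF B, of n "\<lambda>k. h * real k"])
         (use h in \<open>auto simp: strict_mono_on_def\<close>)
    with n show "\<exists>f n. inj_on f {..<n::nat} \<and> J \<subseteq> f ` {..<n} \<and> indep_vars (\<lambda>_. borel) (\<lambda>k. ?X (f k)) {..<n}"
      by (intro exI[of _ id] exI[of _ n]) simp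
  qed (rule X)+
  show "(\<lambda>\<omega> n. ?X n \<omega>) \<in> measurable M (drift_seq ?\<eta>)"
    unfolding measurable_cong_sets[OF refl sets_drift_seq]
    by (rule measurable_PiM_single') (use X(2) in \<open>auto simp: space_PiM\<close>)
qed

lemma distr_zlaw:
  assumes W: "two_sided_brownian_motion N W" and \<eta>: "0 < \<eta>"
  shows "distr N (zlaw \<eta>) (\<lambda>\<omega> j. (if j < 0 then \<eta> else - \<eta>)
      + sqrt 2 * (W (\<eta> * of_int (j + 1)) \<omega> - W (\<eta> * of_int j) \<omega>)) = zlaw \<eta>"
    and "(\<lambda>\<omega> j. (if j < 0 then \<eta> else - \<eta>)
      + sqrt 2 * (W (\<eta> * of_int (j + 1)) \<omega> - W (\<eta> * of_int j) \<omega>)) \<in> measurable N (zlaw \<eta>)"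
proof -
  interpret prob_space N using W by (simp add: brownian_motion_on_def)
  let ?X = "\<lambda>j \<omega>. (if j < 0 then \<eta> else - \<eta>) + sqrt 2 * (W (\<eta> * of_int (j + 1)) \<omega> - W (\<eta> * of_int j) \<omega>)"
  have X: "distr N borel (?X j) = gauss (if j < 0 then \<eta> else - \<eta>) (2 * \<eta>)" "?X j \<in> borel_measurable N" for j
  proof -
    have "\<eta> * real_of_int j < \<eta> * real_of_int (j + 1)" using \<eta> by simp
    moreover have "(sqrt 2)\<^sup>2 * (\<eta> * real_of_int (j + 1) - \<eta> * real_of_int j) = 2 * \<eta>"
      by (simp add: algebra_simps)
    ultimately show "distr N borel (?X j) = gauss (if j < 0 then \<eta> else - \<eta>) (2 * \<eta>)" "?X j \<in> borel_measurable N"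
      using brownian_increment_law[OF W, of "\<eta> * real_of_int j" "\<eta> * real_of_int (j + 1)" "sqrt 2" "if j < 0 then \<eta> else - \<eta>"]
      by auto
  qed
  show "distr N (zlaw \<eta>) (\<lambda>\<omega> j. ?X j \<omega>) = zlaw \<eta>"
    unfolding zlaw_def
  proof (rule distr_eq_PiM)
    fix J :: "int set" assume J: "finite J"
    \<comment> \<open>\<open>J\<close> is enclosed in the integers from -K to K - 1, listed in
      increasing order as the independence of increments requires.\<close>
    define K where "K = nat (Max (insert 0 (abs ` J))) + 1"
    have "\<bar>j\<bar> < int K" if "j \<in> J" for j
    proof -
      have "\<bar>j\<bar> \<le> Max (insert 0 (abs ` J))" "0 \<le> Max (insert 0 (abs ` J))"
        using J that by (auto intro: Max_ge)
      then show ?thesis by (simp add: K_def)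
    qed
    note J_bound = this
    have sub: "J \<subseteq> (\<lambda>k. int k - int K) ` {..<2 * K}"
    proof
      fix j assume "j \<in> J"
      from J_bound[OF this] show "j \<in> (\<lambda>k. int k - int K) ` {..<2 * K}"
        by (intro image_eqI[of _ _ "nat (j + int K)"]) auto
    qed
    have "indep_vars (\<lambda>_. borel) (\<lambda>k. ?X (int k - int K)) {..<2 * K}"
      using brownian_indep_increments[OF W, of "2 * K" "\<lambda>k. \<eta> * of_int (int k - int K)"
          "\<lambda>k. if int k - int K < 0 then \<eta> else - \<eta>" "sqrt 2"] \<eta>
      by (auto simp: strict_mono_on_def algebra_simps)
    with sub show "\<exists>f n. inj_on f {..<n::nat} \<and> J \<subseteq> f ` {..<n} \<and> indep_vars (\<lambda>_. borel) (\<lambda>k. ?X (f k)) {..<n}"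
      by (intro exI[of _ "\<lambda>k. int k - int K"] exI[of _ "2 * K"]) (auto simp: inj_on_def)
  qed (rule X)+
  show "(\<lambda>\<omega> j. ?X j \<omega>) \<in> measurable N (zlaw \<eta>)"
    unfolding measurable_cong_sets[OF refl sets_zlaw]
    by (rule measurable_PiM_single') (use X(2) in \<open>auto simp: space_PiM\<close>)
qed

text \<open>With m = 0 this also covers ordinary ruin on a grid. \<open>B 0\<close> vanishes only
  almost surely, so the events are compared up to null sets.\<close>

lemma prob_grid_exceed:
  fixes u :: real and m :: nat
  assumes B: "standard_brownian_motion M B" and c: "0 < c" and h: "0 < h"
  defines "E \<equiv> {\<omega> \<in> space M. \<exists>k. \<forall>j\<le>m. u + c * (h * real (k + j)) < B (h * real (k + j)) \<omega>}"
  shows "E \<in> sets M" and "emeasure M E = parisian_prob (2 * c\<^sup>2 * h) m (2 * c * u)"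
proof -
  interpret prob_space M using B by (simp add: brownian_motion_on_def)
  let ?\<eta> = "2 * c\<^sup>2 * h"
  have [measurable]: "B (h * real n) \<in> borel_measurable M" for n
    using B h by (auto simp: brownian_motion_on_def)
  show E: "E \<in> sets M" unfolding E_def by measurable
  let ?X = "\<lambda>\<omega> n. - ?\<eta> + 2 * c * (B (h * real (Suc n)) \<omega> - B (h * real n) \<omega>)"
  have walk: "walk (?X \<omega>) n = 2 * c * (B (h * real n) \<omega> - B 0 \<omega> - c * (h * real n))" for \<omega> n
    by (induction n) (simp_all add: walk_def algebra_simps power2_eq_square)
  let ?A = "{\<omega>. \<exists>k. above m (walk \<omega>) (2 * c * u) k}"
  have A: "?A \<in> sets (drift_seq ?\<eta>)"
    unfolding sets_drift_seq by (rule sets_PiM_Collect) measurable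
  have "emeasure M E = emeasure M (?X -` ?A \<inter> space M)"
  proof (rule emeasure_eq_AE)
    show "?X -` ?A \<inter> space M \<in> sets M"
      by (rule measurable_sets[OF distr_drift_seq(2)[OF B c h] A])
    have "AE \<omega> in M. B 0 \<omega> = 0" using B by (simp add: brownian_motion_on_def)
    then show "AE \<omega> in M. \<omega> \<in> E \<longleftrightarrow> \<omega> \<in> ?X -` ?A \<inter> space M"
    proof eventually_elim
      case (elim \<omega>)
      have "2 * c * u < walk (?X \<omega>) n \<longleftrightarrow> u + c * (h * real n) < B (h * real n) \<omega>" for n
        unfolding walk elim using c by (subst mult_less_cancel_left_pos) auto
      then show ?case by (simp add: E_def above_def) blast
    qed
  qed (rule E)
  also have "\<dots> = emeasure (distr M (drift_seq ?\<eta>) ?X) ?A"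
    by (rule emeasure_distr[OF distr_drift_seq(2)[OF B c h] A, symmetric])
  finally show "emeasure M E = parisian_prob ?\<eta> m (2 * c * u)"
    unfolding distr_drift_seq(1)[OF B c h] parisian_prob_def .
qed

lemma parisian_ruin_prob_eq:
  assumes B: "standard_brownian_motion M B" and c: "0 < c" and \<delta>: "0 < \<delta>" and T: "T = \<delta> * real m"
  shows "parisian_ruin_prob M B c \<delta> u T = enn2real (parisian_prob (2 * c\<^sup>2 * \<delta>) m (2 * c * u))"
proof -
  have grid: "{0..} \<inter> grid \<delta> = range (\<lambda>k. \<delta> * real k)"
  proof (intro equalityI subsetI)
    fix t assume "t \<in> {0..} \<inter> grid \<delta>"
    then obtain k where k: "t = \<delta> * of_int k" "0 \<le> \<delta> * of_int k" by (auto simp: grid_def)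
    then have "0 \<le> k" using \<delta> by (simp add: zero_le_mult_iff)
    then show "t \<in> range (\<lambda>k. \<delta> * real k)" using k by (intro image_eqI[of _ _ "nat k"]) auto
  next
    fix t assume "t \<in> range (\<lambda>k. \<delta> * real k)"
    then obtain k where "t = \<delta> * real k" by auto
    then show "t \<in> {0..} \<inter> grid \<delta>" using \<delta> by (auto simp: grid_def intro!: exI[of _ "int k"])
  qed
  have window: "{\<delta> * real k..\<delta> * real k + T} \<inter> grid \<delta> = (\<lambda>j. \<delta> * real (k + j)) ` {..m}" for k
  proof (intro equalityI subsetI)
    fix t assume "t \<in> {\<delta> * real k..\<delta> * real k + T} \<inter> grid \<delta>"
    then obtain i where i: "t = \<delta> * of_int i" "\<delta> * real k \<le> \<delta> * of_int i" "\<delta> * of_int i \<le> \<delta> * (real k + real m)"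
      by (auto simp: grid_def T algebra_simps)
    then have "real k \<le> of_int i" "of_int i \<le> real k + real m" using \<delta> by auto
    then have "int k \<le> i" "i \<le> int k + int m" by linarith+
    then show "t \<in> (\<lambda>j. \<delta> * real (k + j)) ` {..m}"
      using i by (intro image_eqI[of _ _ "nat (i - int k)"]) auto
  next
    fix t assume "t \<in> (\<lambda>j. \<delta> * real (k + j)) ` {..m}"
    then obtain j where "j \<le> m" "t = \<delta> * real (k + j)" by auto
    then show "t \<in> {\<delta> * real k..\<delta> * real k + T} \<inter> grid \<delta>"
      using \<delta> by (auto simp: grid_def T algebra_simps intro!: exI[of _ "int (k + j)"])
  qed
  have "(INF t \<in> {0..} \<inter> grid \<delta>. SUP s \<in> {t..t + T} \<inter> grid \<delta>. ereal (risk_process B c u s \<omega>)) < 0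
    \<longleftrightarrow> (\<exists>k. \<forall>j\<le>m. u + c * (\<delta> * real (k + j)) < B (\<delta> * real (k + j)) \<omega>)" for \<omega>
  proof -
    \<comment> \<open>A window is finite and nonempty, so the strict inequality passes through the
      supremum.\<close>
    have "(SUP s \<in> {\<delta> * real k..\<delta> * real k + T} \<inter> grid \<delta>. ereal (risk_process B c u s \<omega>)) < 0
      \<longleftrightarrow> (\<forall>j\<le>m. u + c * (\<delta> * real (k + j)) < B (\<delta> * real (k + j)) \<omega>)" for k
      unfolding window by (subst finite_Sup_less_iff) (auto simp: risk_process_def zero_ereal_def)
    then show ?thesis
      unfolding grid by (auto simp: INF_less_iff)
  qed
  then show ?thesis
    unfolding parisian_ruin_prob_def measure_def
    using prob_grid_exceed(2)[OF B c \<delta>, of m u] by simp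
qed

lemma parisian_constant_eq:
  assumes W: "two_sided_brownian_motion N W" and \<eta>: "0 < \<eta>"
  shows "parisian_constant N W \<eta> (\<eta> * real m) = enn2real (last_mass \<eta> m / ennreal \<eta>)"
proof -
  let ?X = "\<lambda>\<omega> j. (if j < 0 then \<eta> else - \<eta>) + sqrt 2 * (W (\<eta> * of_int (j + 1)) \<omega> - W (\<eta> * of_int j) \<omega>)"
  let ?e = "\<lambda>\<omega> s. ennreal (exp (sqrt 2 * W s \<omega> - \<bar>s\<bar>))"
  have grid: "grid \<eta> = range (\<lambda>k. \<eta> * of_int k)" by (auto simp: grid_def)
  have inj: "inj (\<lambda>k. \<eta> * real_of_int k)" using \<eta> by (auto simp: inj_on_def)
  have window: "{\<eta> * of_int i..\<eta> * of_int i + \<eta> * real m} \<inter> grid \<eta> = (\<lambda>j. \<eta> * of_int j) ` {i..i + int m}" for i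
  proof (intro equalityI subsetI)
    fix t assume "t \<in> {\<eta> * of_int i..\<eta> * of_int i + \<eta> * real m} \<inter> grid \<eta>"
    then obtain j where j: "t = \<eta> * of_int j" "\<eta> * of_int i \<le> \<eta> * of_int j" "\<eta> * of_int j \<le> \<eta> * (of_int i + real m)"
      by (auto simp: grid_def algebra_simps)
    then have "of_int i \<le> real_of_int j" "of_int j \<le> of_int i + real m" using \<eta> by auto
    then have "i \<le> j" "j \<le> i + int m" by linarith+
    then show "t \<in> (\<lambda>j. \<eta> * of_int j) ` {i..i + int m}" using j by auto
  next
    fix t assume "t \<in> (\<lambda>j. \<eta> * of_int j) ` {i..i + int m}"
    then obtain j where j: "i \<le> j" "j \<le> i + int m" "t = \<eta> * of_int j" by auto
    have "real_of_int j \<le> of_int i + real m" using j(2) by linarith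
    then have "\<eta> * of_int j \<le> \<eta> * (of_int i + real m)" using \<eta> by simp
    then show "t \<in> {\<eta> * of_int i..\<eta> * of_int i + \<eta> * real m} \<inter> grid \<eta>"
      using \<eta> j by (auto simp: grid_def algebra_simps)
  qed
  have "AE \<omega> in N. W 0 \<omega> = 0" using W by (simp add: brownian_motion_on_def)
  then have "(\<integral>\<^sup>+ \<omega>. (SUP t \<in> grid \<eta>. INF s \<in> {t..t + \<eta> * real m} \<inter> grid \<eta>. ?e \<omega> s)
       / (ennreal \<eta> * (\<Sum>\<^sub>\<infinity> t \<in> grid \<eta>. ?e \<omega> t)) \<partial>N)
    = (\<integral>\<^sup>+ \<omega>. zsup m (?X \<omega>) / (ennreal \<eta> * zmass (?X \<omega>)) \<partial>N)"
  proof (intro nn_integral_cong_AE, eventually_elim)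
    case (elim \<omega>)
    have z: "sqrt 2 * W (\<eta> * of_int i) \<omega> - \<bar>\<eta> * of_int i\<bar> = zwalk (?X \<omega>) i" for i
    proof (rule zwalk_unique)
      fix i :: int
      \<comment> \<open>The step from -1 to 0 still belongs to the left half, in agreement with the
        test \<open>j < 0\<close> in \<open>?X\<close>.\<close>
      have "\<bar>i + 1\<bar> = \<bar>i\<bar> - (if i < 0 then 1 else - 1)" by simp
      then have "\<bar>real_of_int (i + 1)\<bar> = \<bar>real_of_int i\<bar> - (if i < 0 then 1 else - 1)"
        by (simp flip: of_int_abs)
      then have "\<bar>\<eta> * real_of_int (i + 1)\<bar> = \<bar>\<eta> * real_of_int i\<bar> - (if i < 0 then \<eta> else - \<eta>)"
        using \<eta> by (simp add: abs_mult right_diff_distrib)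
      then show "sqrt 2 * W (\<eta> * of_int (i + 1)) \<omega> - \<bar>\<eta> * of_int (i + 1)\<bar>
          = sqrt 2 * W (\<eta> * of_int i) \<omega> - \<bar>\<eta> * of_int i\<bar> + ?X \<omega> i"
        by (simp only: right_diff_distrib)
    qed (use elim in simp)
    have "(SUP t \<in> grid \<eta>. INF s \<in> {t..t + \<eta> * real m} \<inter> grid \<eta>. ?e \<omega> s)
        = (SUP i. INF s \<in> {\<eta> * of_int i..\<eta> * of_int i + \<eta> * real m} \<inter> grid \<eta>. ?e \<omega> s)"
      unfolding grid by (simp only: image_image)
    also have "\<dots> = zsup m (?X \<omega>)"
      unfolding window image_image z zsup_def ..
    finally have sup: "(SUP t \<in> grid \<eta>. INF s \<in> {t..t + \<eta> * real m} \<inter> grid \<eta>. ?e \<omega> s) = zsup m (?X \<omega>)" .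
    have "(\<Sum>\<^sub>\<infinity> t \<in> grid \<eta>. ?e \<omega> t) = infsum (?e \<omega> \<circ> (\<lambda>k. \<eta> * of_int k)) UNIV"
      unfolding grid by (rule infsum_reindex[OF inj])
    also have "\<dots> = zmass (?X \<omega>)"
      unfolding infsum_ennreal_eq_nn_integral zmass_def comp_def z ..
    finally show ?case unfolding sup by simp
  qed
  also have "\<dots> = (\<integral>\<^sup>+ \<omega>. zsup m \<omega> / (ennreal \<eta> * zmass \<omega>) \<partial>distr N (zlaw \<eta>) ?X)"
    by (rule nn_integral_distr[symmetric, OF distr_zlaw(2)[OF W \<eta>]]) measurable
  also have "\<dots> = last_mass \<eta> m / ennreal \<eta>"
    unfolding distr_zlaw(1)[OF W \<eta>] by (rule expectation_zsup[OF \<eta>])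
  finally show ?thesis unfolding parisian_constant_def by simp
qed

section \<open>The classical ruin probability in continuous time\<close>

lemma parisian_prob_0_le:
  assumes \<eta>: "0 < \<eta>"
  shows "parisian_prob \<eta> 0 a \<le> ennreal (exp (- a))"
proof -
  have "parisian_prob \<eta> 0 a = emeasure (drift_seq \<eta>) (\<Union>n. {\<omega>. \<exists>k\<le>n. a < walk \<omega> k})"
  proof -
    have "{\<omega>. \<exists>k. above 0 (walk \<omega>) a k} = (\<Union>n. {\<omega>. \<exists>k\<le>n. a < walk \<omega> k})"
      by (auto simp: above_def)
    then show ?thesis unfolding parisian_prob_def by simp
  qed
  also have "\<dots> = (SUP n. exceed_prob \<eta> n a)"
    unfolding exceed_prob_def
    by (intro SUP_emeasure_incseq[symmetric]) (auto simp: sets_exceed incseq_def intro: order_trans)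
  also have "\<dots> \<le> ennreal (exp (- a))"
    by (intro SUP_least exceed_prob_le \<eta>)
  finally show ?thesis .
qed

lemma exceed_prob_le_parisian_prob: "exceed_prob \<eta> n a \<le> parisian_prob \<eta> 0 a"
proof -
  have "{\<omega>. \<exists>k. above 0 (walk \<omega>) a k} \<in> sets (drift_seq \<eta>)"
    unfolding sets_drift_seq by (rule sets_PiM_Collect) measurable
  moreover have "{\<omega>. \<exists>k\<le>n. a < walk \<omega> k} \<subseteq> {\<omega>. \<exists>k. above 0 (walk \<omega>) a k}"
    by (auto simp: above_def)
  ultimately show ?thesis
    unfolding exceed_prob_def parisian_prob_def by (intro emeasure_mono)
qed

text \<open>Ruin is a strict inequality along a continuous path, so it persists at dyadic times
  close to a ruin time.\<close>

lemma ruin_event_dyadic: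
  assumes cont: "continuous_on {0..} (\<lambda>t. B t \<omega>)"
  shows "(INF t \<in> {0..}. ereal (risk_process B c u t \<omega>)) < 0
    \<longleftrightarrow> (\<exists>n k. u + c * (real k / 2 ^ n) < B (real k / 2 ^ n) \<omega>)"
proof
  let ?f = "\<lambda>t. B t \<omega> - c * t"
  assume "(INF t \<in> {0..}. ereal (risk_process B c u t \<omega>)) < 0"
  then obtain t where t: "0 \<le> t" "u < ?f t"
    by (auto simp: INF_less_iff risk_process_def zero_ereal_def)
  \<comment> \<open>Rounding up keeps the approximations nonnegative, where the path is known to be
    continuous.\<close>
  define d where "d n = real (nat \<lceil>t * 2 ^ n\<rceil>) / 2 ^ n" for n :: nat
  have d_bounds: "t \<le> d n" "d n \<le> t + 1 / 2 ^ n" for n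
  proof -
    have "real (nat \<lceil>t * 2 ^ n\<rceil>) = of_int \<lceil>t * 2 ^ n\<rceil>" using t(1) by (simp add: of_nat_nat)
    moreover have "t * 2 ^ n \<le> of_int \<lceil>t * 2 ^ n\<rceil>" "of_int \<lceil>t * 2 ^ n\<rceil> \<le> t * 2 ^ n + 1" by linarith+
    ultimately show "t \<le> d n" "d n \<le> t + 1 / 2 ^ n" by (auto simp: d_def field_simps)
  qed
  have "d \<longlonglongrightarrow> t"
  proof (rule tendsto_sandwich[OF _ _ tendsto_const])
    have "(\<lambda>n. t + (1 / 2) ^ n) \<longlonglongrightarrow> t + 0"
      by (intro tendsto_intros LIMSEQ_realpow_zero) auto
    then show "(\<lambda>n. t + 1 / 2 ^ n) \<longlonglongrightarrow> t" by (simp add: power_one_over)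
  qed (use d_bounds in auto)
  moreover have "continuous_on {0..} ?f" by (intro continuous_intros cont)
  ultimately have "(\<lambda>n. ?f (d n)) \<longlonglongrightarrow> ?f t"
    using t(1) order_trans[OF t(1) d_bounds(1)]
    by (intro continuous_on_tendsto_compose[of "{0..}" ?f]) auto
  then have "\<forall>\<^sub>F n in sequentially. u < ?f (d n)"
    using t(2) by (rule order_tendstoD)
  then obtain n where "u < ?f (d n)" by (auto simp: eventually_sequentially)
  then show "\<exists>n k. u + c * (real k / 2 ^ n) < B (real k / 2 ^ n) \<omega>"
    unfolding d_def by (intro exI) (simp add: algebra_simps)
next
  assume "\<exists>n k. u + c * (real k / 2 ^ n) < B (real k / 2 ^ n) \<omega>"
  then obtain n k where "u + c * (real k / 2 ^ n) < B (real k / 2 ^ n) \<omega>" by blast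
  then show "(INF t \<in> {0..}. ereal (risk_process B c u t \<omega>)) < 0"
    by (subst INF_less_iff) (auto simp: risk_process_def zero_ereal_def intro!: bexI[of _ "real k / 2 ^ n"])
qed

lemma ruin_prob_eq:
  assumes B: "standard_brownian_motion M B" and c: "0 < c" and u: "0 \<le> u"
  shows "ruin_prob M B c u = exp (- (2 * c * u))"
proof -
  interpret prob_space M using B by (simp add: brownian_motion_on_def)
  let ?a = "2 * c * u"
  define h :: "nat \<Rightarrow> real" where "h n = 1 / 2 ^ n" for n :: nat
  have h: "0 < h n" for n by (simp add: h_def)
  define E where "E n = {\<omega> \<in> space M. \<exists>k. \<forall>j\<le>0. u + c * (h n * real (k + j)) < B (h n * real (k + j)) \<omega>}" for n
  note E = prob_grid_exceed[OF B c h, where m = 0 and u = u, folded E_def]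
  have "{\<omega> \<in> space M. (INF t \<in> {0..}. ereal (risk_process B c u t \<omega>)) < 0}
      = {\<omega> \<in> space M. \<exists>n k. u + c * (real k / 2 ^ n) < B (real k / 2 ^ n) \<omega>}"
    using B by (intro Collect_cong conj_cong refl ruin_event_dyadic) (simp add: brownian_motion_on_def)
  also have "\<dots> = (\<Union>n. E n)"
    by (auto simp: E_def h_def)
  finally have "{\<omega> \<in> space M. (INF t \<in> {0..}. ereal (risk_process B c u t \<omega>)) < 0} = (\<Union>n. E n)" .
  then have ruin: "ruin_prob M B c u = prob (\<Union>n. E n)"
    by (simp add: ruin_prob_def)
  have inc: "incseq E"
  proof (rule incseq_SucI, rule subsetI)
    fix n \<omega> assume "\<omega> \<in> E n"
    then obtain k where "\<omega> \<in> space M" "u + c * (h n * real k) < B (h n * real k) \<omega>" by (auto simp: E_def)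
    moreover have "h n * real k = h (Suc n) * real (2 * k)" by (simp add: h_def)
    ultimately show "\<omega> \<in> E (Suc n)" by (auto simp: E_def intro!: exI[of _ "2 * k"])
  qed
  have lim: "(\<lambda>n. prob (E n)) \<longlonglongrightarrow> ruin_prob M B c u"
    unfolding ruin using E(1) inc by (intro finite_Lim_measure_incseq) auto
  have \<eta>: "0 < 2 * c\<^sup>2 * h n" for n using c h by simp
  have upper: "prob (E n) \<le> exp (- ?a)" for n
  proof -
    have "ennreal (prob (E n)) \<le> ennreal (exp (- ?a))"
      using parisian_prob_0_le[OF \<eta>] E(2) by (simp add: emeasure_eq_measure[symmetric])
    then show ?thesis by simp
  qed
  have ruin_le: "prob (E n) \<le> ruin_prob M B c u" for n
    unfolding ruin using E(1) by (intro finite_measure_mono) auto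
  \<comment> \<open>\<open>K\<close> is the time horizon, reached after \<open>K * 2 ^ n\<close>
    steps. The limits are taken in the order mesh to 0, horizon to infinity, \<epsilon> to 0,
    because on a fixed mesh the large-step error grows with \<open>K\<close>.\<close>
  have lower: "1 \<le> exp (?a + \<epsilon>) * ruin_prob M B c u + exp (?a / 2 - c\<^sup>2 * real K / 2)"
    if \<epsilon>: "0 < \<epsilon>" for \<epsilon> K
  proof -
    define A where "A = 2 * c\<^sup>2"
    have A: "0 < A" using c by (simp add: A_def)
    \<comment> \<open>The bound of \<open>gauss_tail\<close> at \<eta> = A/x, where x = 2^n is the
      number of steps per unit of time.\<close>
    let ?\<kappa> = "\<lambda>x. exp (1 + sqrt (A / x) - \<epsilon> / sqrt (A / x))"
    have bound: "1 \<le> exp (?a + \<epsilon>) * ruin_prob M B c u + real K * 2 ^ n * ?\<kappa> (2 ^ n) + exp (?a / 2 - c\<^sup>2 * real K / 2)" for n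
    proof -
      let ?\<eta> = "2 * c\<^sup>2 * h n"
      have \<eta>A: "?\<eta> = A / 2 ^ n" by (simp add: A_def h_def)
      have "1 \<le> ennreal (exp (?a + \<epsilon>)) * exceed_prob ?\<eta> (K * 2 ^ n) ?a
          + of_nat (K * 2 ^ n) * ennreal (?\<kappa> (2 ^ n)) + ennreal (exp (?a / 2 - real (K * 2 ^ n) * ?\<eta> / 4))"
        using gauss_tail[OF \<eta>[of n], of \<epsilon>] \<epsilon> c u unfolding \<eta>A
        by (intro exceed_prob_ge) (use A in \<open>auto intro: order_trans[of _ 0]\<close>)
      also have "\<dots> \<le> ennreal (exp (?a + \<epsilon>)) * ennreal (prob (E n))
          + of_nat (K * 2 ^ n) * ennreal (?\<kappa> (2 ^ n)) + ennreal (exp (?a / 2 - real (K * 2 ^ n) * ?\<eta> / 4))"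
        using exceed_prob_le_parisian_prob[of ?\<eta> "K * 2 ^ n" ?a] E(2)[of n]
        by (intro add_mono mult_left_mono) (auto simp: emeasure_eq_measure)
      also have "\<dots> = ennreal (exp (?a + \<epsilon>) * prob (E n) + real (K * 2 ^ n) * ?\<kappa> (2 ^ n)
          + exp (?a / 2 - real (K * 2 ^ n) * ?\<eta> / 4))"
        by (simp add: ennreal_mult ennreal_of_nat_eq_real_of_nat)
      finally have "1 \<le> exp (?a + \<epsilon>) * prob (E n) + real (K * 2 ^ n) * ?\<kappa> (2 ^ n)
          + exp (?a / 2 - real (K * 2 ^ n) * ?\<eta> / 4)"
        by (subst (asm) ennreal_1[symmetric], subst (asm) ennreal_le_iff) (auto intro!: add_nonneg_nonneg)
      also have "real (K * 2 ^ n) * ?\<eta> / 4 = c\<^sup>2 * real K / 2" by (simp add: h_def)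
      also have "exp (?a + \<epsilon>) * prob (E n) \<le> exp (?a + \<epsilon>) * ruin_prob M B c u"
        using ruin_le by (intro mult_left_mono) auto
      finally show ?thesis by simp
    qed
    have "((\<lambda>x. real K * x * ?\<kappa> x) \<longlongrightarrow> 0) at_top"
      using A \<epsilon> by real_asymp
    moreover have "filterlim (\<lambda>n. 2 ^ n :: real) at_top sequentially"
      by real_asymp
    ultimately have "(\<lambda>n. real K * 2 ^ n * ?\<kappa> (2 ^ n)) \<longlonglongrightarrow> 0"
      by (rule filterlim_compose)
    then have "(\<lambda>n. exp (?a + \<epsilon>) * ruin_prob M B c u + real K * 2 ^ n * ?\<kappa> (2 ^ n) + exp (?a / 2 - c\<^sup>2 * real K / 2))
        \<longlonglongrightarrow> exp (?a + \<epsilon>) * ruin_prob M B c u + 0 + exp (?a / 2 - c\<^sup>2 * real K / 2)"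
      by (intro tendsto_intros)
    then have "1 \<le> exp (?a + \<epsilon>) * ruin_prob M B c u + 0 + exp (?a / 2 - c\<^sup>2 * real K / 2)"
      by (rule tendsto_lowerbound) (use bound in auto)
    then show ?thesis by simp
  qed
  have "(\<lambda>K. exp (?a + \<epsilon>) * ruin_prob M B c u + exp (?a / 2 - c\<^sup>2 * real K / 2))
      \<longlonglongrightarrow> exp (?a + \<epsilon>) * ruin_prob M B c u + 0" for \<epsilon>
    by (intro tendsto_intros) (use c in real_asymp)
  then have "1 \<le> exp (?a + \<epsilon>) * ruin_prob M B c u" if "0 < \<epsilon>" for \<epsilon>
    using lower[OF that] tendsto_lowerbound[of _ "exp (?a + \<epsilon>) * ruin_prob M B c u" sequentially 1] by force
  then have "\<forall>\<^sub>F \<epsilon> in at_right 0. 1 \<le> exp (?a + \<epsilon>) * ruin_prob M B c u"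
    by (auto simp: eventually_at_filter)
  moreover have "((\<lambda>\<epsilon>. exp (?a + \<epsilon>) * ruin_prob M B c u) \<longlongrightarrow> exp (?a + 0) * ruin_prob M B c u) (at_right 0)"
    by (intro tendsto_intros)
  ultimately have "1 \<le> exp (?a + 0) * ruin_prob M B c u"
    by (intro tendsto_lowerbound) auto
  then have "exp (- ?a) \<le> ruin_prob M B c u"
    by (simp add: exp_minus field_simps)
  moreover have "ruin_prob M B c u \<le> exp (- ?a)"
    by (rule tendsto_upperbound[OF lim]) (use upper in auto)
  ultimately show ?thesis by simp
qed

theorem theorem4p1:
  fixes M :: "'a measure" and B :: "real \<Rightarrow> 'a \<Rightarrow> real"
    and N :: "'b measure" and W :: "real \<Rightarrow> 'b \<Rightarrow> real"
    and c \<delta> T :: real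
  assumes "standard_brownian_motion M B"
    and "two_sided_brownian_motion N W"
    and "c > 0" and "\<delta> > 0" and "T > 0"
    and "T / \<delta> \<in> \<int>"
  shows "((\<lambda>u. parisian_ruin_prob M B c \<delta> u T
            / (parisian_constant N W (2 * c\<^sup>2 * \<delta>) (2 * c\<^sup>2 * T) * ruin_prob M B c u))
          \<longlongrightarrow> 1) at_top"
proof -
  define \<eta> where "\<eta> = 2 * c\<^sup>2 * \<delta>"
  have \<eta>: "0 < \<eta>" using assms by (simp add: \<eta>_def)
  obtain k :: int where k: "T / \<delta> = of_int k" using assms(6) by (rule Ints_cases)
  define m where "m = nat k"
  have "0 < T / \<delta>" using assms by simp
  then have m: "T = \<delta> * real m" using k assms by (simp add: m_def field_simps)
  have "2 * c\<^sup>2 * T = \<eta> * real m" by (simp add: \<eta>_def m)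
  then have const: "parisian_constant N W (2 * c\<^sup>2 * \<delta>) (2 * c\<^sup>2 * T) = enn2real (last_mass \<eta> m / ennreal \<eta>)"
    unfolding \<eta>_def[symmetric] by (simp only: parisian_constant_eq[OF assms(2) \<eta>])
  define L where "L = enn2real (last_mass \<eta> m)"
  have lm: "last_mass \<eta> m = ennreal L"
    using last_mass_le_1[OF \<eta>, of m] by (auto simp: L_def ennreal_enn2real_if top_unique)
  \<comment> \<open>A zero limit would make the quotient in the claim meaningless.\<close>
  have L: "0 < L"
    using last_mass_pos[OF \<eta>, of m] unfolding lm by (auto simp: ennreal_eq_0_iff not_le)
  have H: "enn2real (last_mass \<eta> m / ennreal \<eta>) = L / \<eta>"
    unfolding lm using L \<eta> by (simp add: divide_ennreal)
  have "filterlim (\<lambda>u. 2 * c * u) at_top at_top"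
    using assms(3) by real_asymp
  with parisian_prob_limit[OF \<eta>, of m]
  have "((\<lambda>u. exp (2 * c * u) * enn2real (parisian_prob \<eta> m (2 * c * u))) \<longlongrightarrow> L / \<eta>) at_top"
    unfolding L_def by (rule filterlim_compose)
  then have "((\<lambda>u. exp (2 * c * u) * enn2real (parisian_prob \<eta> m (2 * c * u)) / (L / \<eta>)) \<longlongrightarrow> L / \<eta> / (L / \<eta>)) at_top"
    using L \<eta> by (intro tendsto_intros) auto
  then have "((\<lambda>u. exp (2 * c * u) * enn2real (parisian_prob \<eta> m (2 * c * u)) / (L / \<eta>)) \<longlongrightarrow> 1) at_top"
    using L \<eta> by simp
  then show ?thesis
  proof (rule Lim_transform_eventually)
    show "\<forall>\<^sub>F u in at_top. exp (2 * c * u) * enn2real (parisian_prob \<eta> m (2 * c * u)) / (L / \<eta>)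
        = parisian_ruin_prob M B c \<delta> u T
            / (parisian_constant N W (2 * c\<^sup>2 * \<delta>) (2 * c\<^sup>2 * T) * ruin_prob M B c u)"
      \<comment> \<open>From u = 0 on the two expressions agree exactly, since the classical ruin
        probability equals exp(-2cu).\<close>
      using eventually_ge_at_top[of 0]
    proof eventually_elim
      case (elim u)
      show ?case
        unfolding const H parisian_ruin_prob_eq[OF assms(1,3,4) m, folded \<eta>_def] ruin_prob_eq[OF assms(1,3) elim]
        by (simp add: exp_minus field_simps)
    qed
  qed
qed

end
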